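(* Let $n\geq 3$, let $\mathcal{O}$ be the ring of integers of a number field and let $G=\mathrm{T}_n(\mathcal{O})$ be the group of all invertible upper triangular $n\times n$ matrices over $\mathcal{O}$. Assume that $\mathcal{O}$ has a finite group of units $\mathcal{O}^\times$ with generators $\alpha_1,\ldots,\alpha_l$, and let $\beta_1,\ldots,\beta_m$ be free generators of $\mathcal{O}$ as a $\mathbb{Z}$-module. Let $\bar t(\bar\beta)$ be the tuple of all $t_{ij}(\beta_k)=\mathbf{1}+\beta_k e_{ij}$, $1\leq i<j\leq n$, $1\leq k\leq m$, and let $\bar d(\bar\alpha)$ be the tuple of all $d_i(\alpha_k)$, $1\leq i\leq n$, $1\leq k\leq l$. Then the ring $\mathcal{O}$ is bi-interpretable with $(G,\bar t(\bar\beta),\bar d(\bar\alpha))$.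
   Context: Here $e_{ij}$ is the $n\times n$ matrix with $ij$-th entry $1$ and all other entries $0$, $\mathbf{1}$ is the identity matrix, and $d_i(\alpha)$ is the diagonal matrix with $i$-th diagonal entry $\alpha$ and all other diagonal entries $1$. Rings are viewed in the first-order language of unitary rings, groups in the first-order language of groups. For a structure $\mathfrak{B}$ and a tuple $\bar b$ of its elements, $(\mathfrak{B},\bar b)$ means that the elements of $\bar b$ may be used as parameters (constants) in formulas over $\mathfrak{B}$. Bi-interpretability: let $\mathfrak{A},\mathfrak{B}$ be structures in possibly different signatures. Assume $\mathfrak{A}$ is interpretable in $\mathfrak{B}$ via an interpretation $\Delta$ and $\mathfrak{B}$ is interpretable in $\mathfrak{A}$ via an interpretation $\Gamma$. Composing the two interpretations gives an isomorphic copy $\tilde{\mathfrak{A}}$ of $\mathfrak{A}$ defined in $\mathfrak{A}$ and an isomorphic copy $\tilde{\mathfrak{B}}$ of $\mathfrak{B}$ defined in $\mathfrak{B}$. Then $\mathfrak{A}$ is bi-interpretable with $\mathfrak{B}$ if (for some such $\Delta,\Gamma$) there is an isomorphism $\mathfrak{A}\cong\tilde{\mathfrak{A}}$ first-order definable in $\mathfrak{A}$ and an isomorphism $\mathfrak{B}\cong\tilde{\mathfrak{B}}$ first-order definable in $\mathfrak{B}$. *)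

theory Defs
  imports
    "Jordan_Normal_Form.Matrix"
    "HOL-Algebra.Generated_Groups"
    "HOL-Computational_Algebra.Polynomial"
begin

section \<open>First-order languages and structures\<close>

text \<open>A signature assigns an arity to each of its symbols; a type element that is mapped to
  \<open>None\<close> is not a symbol of the signature.\<close>

record ('f, 'r) signature =
  fun_arity :: "'f \<Rightarrow> nat option"
  rel_arity :: "'r \<Rightarrow> nat option"

record ('f, 'r, 'a) struc =
  univ :: "'a set"
  fint :: "'f \<Rightarrow> 'a list \<Rightarrow> 'a"
  rint :: "'r \<Rightarrow> 'a list \<Rightarrow> bool"

text \<open>Variables are de Bruijn indices: \<open>Exists\<close> binds index 0 and shifts the others.\<close>

datatype 'f fo_term = Variable nat | Apply 'f "'f fo_term list"

datatype ('f, 'r) formula =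
    Equal "'f fo_term" "'f fo_term"
  | Related 'r "'f fo_term list"
  | Negation "('f, 'r) formula"
  | Conjunction "('f, 'r) formula" "('f, 'r) formula"
  | Exists "('f, 'r) formula"

text \<open>The numeric argument bounds the free variables: all of them are less than \<open>n\<close>.\<close>

fun wf_term :: "('f, 'r) signature \<Rightarrow> nat \<Rightarrow> 'f fo_term \<Rightarrow> bool" where
  "wf_term L n (Variable i) \<longleftrightarrow> i < n"
| "wf_term L n (Apply f ts) \<longleftrightarrow> fun_arity L f = Some (length ts) \<and> (\<forall>t \<in> set ts. wf_term L n t)"

fun wf_formula :: "('f, 'r) signature \<Rightarrow> nat \<Rightarrow> ('f, 'r) formula \<Rightarrow> bool" where
  "wf_formula L n (Equal s t) \<longleftrightarrow> wf_term L n s \<and> wf_term L n t"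
| "wf_formula L n (Related r ts) \<longleftrightarrow>
     rel_arity L r = Some (length ts) \<and> (\<forall>t \<in> set ts. wf_term L n t)"
| "wf_formula L n (Negation p) \<longleftrightarrow> wf_formula L n p"
| "wf_formula L n (Conjunction p q) \<longleftrightarrow> wf_formula L n p \<and> wf_formula L n q"
| "wf_formula L n (Exists p) \<longleftrightarrow> wf_formula L (Suc n) p"

fun eval_term :: "('f, 'r, 'a) struc \<Rightarrow> (nat \<Rightarrow> 'a) \<Rightarrow> 'f fo_term \<Rightarrow> 'a" where
  "eval_term M e (Variable i) = e i"
| "eval_term M e (Apply f ts) = fint M f (map (eval_term M e) ts)"

fun sat :: "('f, 'r, 'a) struc \<Rightarrow> (nat \<Rightarrow> 'a) \<Rightarrow> ('f, 'r) formula \<Rightarrow> bool" where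
  "sat M e (Equal s t) \<longleftrightarrow> eval_term M e s = eval_term M e t"
| "sat M e (Related r ts) \<longleftrightarrow> rint M r (map (eval_term M e) ts)"
| "sat M e (Negation p) \<longleftrightarrow> \<not> sat M e p"
| "sat M e (Conjunction p q) \<longleftrightarrow> sat M e p \<and> sat M e q"
| "sat M e (Exists p) \<longleftrightarrow> (\<exists>a \<in> univ M. sat M (case_nat a e) p)"

text \<open>Satisfaction by a finite tuple. It is only used for formulas whose free variables are less
  than the length of the tuple, so the unspecified values of \<open>(!)\<close> never matter.\<close>

abbreviation sat_list :: "('f, 'r, 'a) struc \<Rightarrow> 'a list \<Rightarrow> ('f, 'r) formula \<Rightarrow> bool" where
  "sat_list M xs p \<equiv> sat M ((!) xs) p"

definition tuples :: "('f, 'r, 'a) struc \<Rightarrow> nat \<Rightarrow> 'a list set" where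
  "tuples M k = {xs. length xs = k \<and> set xs \<subseteq> univ M}"

text \<open>\<open>X\<close> is a subset of the \<open>k\<close>-th power of \<open>M\<close> definable with parameters from \<open>P\<close>. The
  parameters are substituted for the variables \<open>k, k + 1, \<dots>\<close>.\<close>

definition definable ::
  "('f, 'r) signature \<Rightarrow> ('f, 'r, 'a) struc \<Rightarrow> 'a set \<Rightarrow> nat \<Rightarrow> 'a list set \<Rightarrow> bool" where
  "definable L M P k X \<longleftrightarrow>
     (\<exists>ps p. set ps \<subseteq> P \<and> wf_formula L (k + length ps) p \<and>
        X = {xs \<in> tuples M k. sat_list M (xs @ ps) p})"

definition struc_iso ::
  "('f, 'r) signature \<Rightarrow> ('a \<Rightarrow> 'b) \<Rightarrow> ('f, 'r, 'a) struc \<Rightarrow> ('f, 'r, 'b) struc \<Rightarrow> bool" where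
  "struc_iso L h M N \<longleftrightarrow>
     bij_betw h (univ M) (univ N) \<and>
     (\<forall>f k. fun_arity L f = Some k \<longrightarrow>
        (\<forall>xs \<in> tuples M k. h (fint M f xs) = fint N f (map h xs))) \<and>
     (\<forall>r k. rel_arity L r = Some k \<longrightarrow>
        (\<forall>xs \<in> tuples M k. rint M r xs \<longleftrightarrow> rint N r (map h xs)))"


section \<open>Interpretations\<close>

text \<open>An interpretation, in structures of signature \<open>('g, 's)\<close>, of structures of signature
  \<open>('f, 'r)\<close> whose elements are classes of \<open>interp_dim\<close>-tuples. In each formula the variables for
  the tuples come first and are followed by those for the parameters. The formula
  \<open>interp_fun f\<close> describes the graph of \<open>f\<close>, with the value as last tuple.\<close>

record ('f, 'r, 'g, 's) interp =
  interp_dim :: nat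
  interp_dom :: "('g, 's) formula"
  interp_eq  :: "('g, 's) formula"
  interp_fun :: "'f \<Rightarrow> ('g, 's) formula"
  interp_rel :: "'r \<Rightarrow> ('g, 's) formula"

definition dom_tuples ::
  "('f, 'r, 'g, 's) interp \<Rightarrow> ('g, 's, 'b) struc \<Rightarrow> 'b list \<Rightarrow> 'b list set" where
  "dom_tuples I N ps = {xs \<in> tuples N (interp_dim I). sat_list N (xs @ ps) (interp_dom I)}"

definition eq_tuples ::
  "('f, 'r, 'g, 's) interp \<Rightarrow> ('g, 's, 'b) struc \<Rightarrow> 'b list \<Rightarrow> ('b list \<times> 'b list) set" where
  "eq_tuples I N ps = {(xs, ys). xs \<in> dom_tuples I N ps \<and> ys \<in> dom_tuples I N ps \<and>
     sat_list N (xs @ ys @ ps) (interp_eq I)}"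

definition interpreted_fun ::
  "('f, 'r, 'g, 's) interp \<Rightarrow> ('g, 's, 'b) struc \<Rightarrow> 'b list \<Rightarrow> 'f \<Rightarrow>
   'b list set list \<Rightarrow> 'b list set \<Rightarrow> bool" where
  "interpreted_fun I N ps f Xs Y \<longleftrightarrow>
     (\<exists>xss ys. list_all2 (\<in>) xss Xs \<and> ys \<in> Y \<and>
        sat_list N (concat xss @ ys @ ps) (interp_fun I f))"

definition interpreted_rel ::
  "('f, 'r, 'g, 's) interp \<Rightarrow> ('g, 's, 'b) struc \<Rightarrow> 'b list \<Rightarrow> 'r \<Rightarrow> 'b list set list \<Rightarrow> bool" where
  "interpreted_rel I N ps r Xs \<longleftrightarrow>
     (\<exists>xss. list_all2 (\<in>) xss Xs \<and> sat_list N (concat xss @ ps) (interp_rel I r))"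

text \<open>The structure that the interpretation \<open>I\<close> defines in \<open>N\<close> with parameters \<open>ps\<close>.\<close>

definition interpreted_struc ::
  "('f, 'r, 'g, 's) interp \<Rightarrow> ('g, 's, 'b) struc \<Rightarrow> 'b list \<Rightarrow> ('f, 'r, 'b list set) struc" where
  "interpreted_struc I N ps =
     \<lparr> univ = dom_tuples I N ps // eq_tuples I N ps,
       fint = (\<lambda>f Xs. THE Y. Y \<in> dom_tuples I N ps // eq_tuples I N ps \<and>
                 interpreted_fun I N ps f Xs Y),
       rint = interpreted_rel I N ps \<rparr>"

definition wf_interp ::
  "('f, 'r) signature \<Rightarrow> ('g, 's) signature \<Rightarrow> ('f, 'r, 'g, 's) interp \<Rightarrow> nat \<Rightarrow> bool" where
  "wf_interp L L' I q \<longleftrightarrow>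
     wf_formula L' (interp_dim I + q) (interp_dom I) \<and>
     wf_formula L' (2 * interp_dim I + q) (interp_eq I) \<and>
     (\<forall>f k. fun_arity L f = Some k \<longrightarrow>
        wf_formula L' ((k + 1) * interp_dim I + q) (interp_fun I f)) \<and>
     (\<forall>r k. rel_arity L r = Some k \<longrightarrow>
        wf_formula L' (k * interp_dim I + q) (interp_rel I r))"

text \<open>The formulas of \<open>I\<close> define an \<open>L\<close>-structure in the \<open>L'\<close>-structure \<open>N\<close>: the equivalence is
  one, the formulas for the symbols respect it, and those for function symbols define functions.\<close>

definition interpretation_in ::
  "('f, 'r) signature \<Rightarrow> ('f, 'r, 'g, 's) interp \<Rightarrow>
   ('g, 's) signature \<Rightarrow> ('g, 's, 'b) struc \<Rightarrow> 'b list \<Rightarrow> bool" where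
  "interpretation_in L I L' N ps \<longleftrightarrow>
     wf_interp L L' I (length ps) \<and>
     equiv (dom_tuples I N ps) (eq_tuples I N ps) \<and>
     (\<forall>f k. fun_arity L f = Some k \<longrightarrow>
        (\<forall>xss yss. length xss = k + 1 \<and>
           list_all2 (\<lambda>xs ys. (xs, ys) \<in> eq_tuples I N ps) xss yss \<longrightarrow>
           (sat_list N (concat xss @ ps) (interp_fun I f) \<longleftrightarrow>
            sat_list N (concat yss @ ps) (interp_fun I f))) \<and>
        (\<forall>Xs \<in> tuples (interpreted_struc I N ps) k.
           \<exists>!Y. Y \<in> univ (interpreted_struc I N ps) \<and> interpreted_fun I N ps f Xs Y)) \<and>
     (\<forall>r k. rel_arity L r = Some k \<longrightarrow>
        (\<forall>xss yss. length xss = k \<and>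
           list_all2 (\<lambda>xs ys. (xs, ys) \<in> eq_tuples I N ps) xss yss \<longrightarrow>
           (sat_list N (concat xss @ ps) (interp_rel I r) \<longleftrightarrow>
            sat_list N (concat yss @ ps) (interp_rel I r))))"


section \<open>Bi-interpretability\<close>

text \<open>Let \<open>\<Gamma>\<close> be an interpretation in \<open>M\<close> with parameters \<open>qs\<close>, and let \<open>\<Delta>\<close> be an interpretation of
  dimension \<open>k\<close> evaluated in \<open>interpreted_struc \<Gamma> M qs\<close>. An element of the resulting structure is a
  class of \<open>k\<close>-tuples of classes of tuples over \<open>M\<close>, hence it is represented by
  \<open>(k * interp_dim \<Gamma>)\<close>-tuples over \<open>M\<close>. For a map \<open>h\<close> from \<open>M\<close> to that structure,
  \<open>flat_graph \<Gamma> M qs k h\<close> is its graph in terms of these representatives.\<close>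

definition flat_graph ::
  "('f, 'r, 'g, 's) interp \<Rightarrow> ('g, 's, 'a) struc \<Rightarrow> 'a list \<Rightarrow> nat \<Rightarrow>
   ('a \<Rightarrow> 'a list set list set) \<Rightarrow> 'a list set" where
  "flat_graph \<Gamma> M qs k h =
     {a # concat wss | a wss.
        a \<in> univ M \<and> length wss = k \<and> set wss \<subseteq> dom_tuples \<Gamma> M qs \<and>
        map (\<lambda>ws. eq_tuples \<Gamma> M qs `` {ws}) wss \<in> h a}"

text \<open>Bi-interpretability of \<open>(A, P)\<close> with \<open>(B, Q)\<close>, where formulas over \<open>A\<close> may use parameters from
  \<open>P\<close> and formulas over \<open>B\<close> parameters from \<open>Q\<close>. The copy of \<open>A\<close> in \<open>A\<close> is obtained by evaluating
  \<open>\<Delta>\<close> in the copy of \<open>B\<close> in \<open>A\<close>, so the parameters of \<open>\<Delta>\<close> are replaced by their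
  images \<open>map g ps\<close> in that copy; likewise for \<open>B\<close>. The elements of \<open>P\<close> and \<open>Q\<close> are available as
  parameters only: \<open>\<Gamma>\<close> interprets the structure \<open>B\<close>, not its expansion by constants for \<open>Q\<close>.\<close>

definition bi_interpretable ::
  "('f, 'r) signature \<Rightarrow> ('f, 'r, 'a) struc \<Rightarrow> 'a set \<Rightarrow>
   ('g, 's) signature \<Rightarrow> ('g, 's, 'b) struc \<Rightarrow> 'b set \<Rightarrow> bool" where
  "bi_interpretable L A P L' B Q \<longleftrightarrow>
     (\<exists>(\<Delta> :: ('f, 'r, 'g, 's) interp) (\<Gamma> :: ('g, 's, 'f, 'r) interp) ps qs f g.
        set ps \<subseteq> Q \<and> set qs \<subseteq> P \<and>
        interpretation_in L \<Delta> L' B ps \<and> struc_iso L f A (interpreted_struc \<Delta> B ps) \<and>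
        interpretation_in L' \<Gamma> L A qs \<and> struc_iso L' g B (interpreted_struc \<Gamma> A qs) \<and>
        (\<exists>\<phi>. struc_iso L \<phi> A
               (interpreted_struc \<Delta> (interpreted_struc \<Gamma> A qs) (map g ps)) \<and>
             definable L A P (1 + interp_dim \<Delta> * interp_dim \<Gamma>)
               (flat_graph \<Gamma> A qs (interp_dim \<Delta>) \<phi>)) \<and>
        (\<exists>\<psi>. struc_iso L' \<psi> B
               (interpreted_struc \<Gamma> (interpreted_struc \<Delta> B ps) (map f qs)) \<and>
             definable L' B Q (1 + interp_dim \<Gamma> * interp_dim \<Delta>)
               (flat_graph \<Delta> B ps (interp_dim \<Gamma>) \<psi>)))"


section \<open>Rings and groups as first-order structures\<close>

datatype ring_symbol = RZero | ROne | RPlus | RMinus | RTimes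

fun ring_arity :: "ring_symbol \<Rightarrow> nat" where
  "ring_arity RZero = 0"
| "ring_arity ROne = 0"
| "ring_arity RPlus = 2"
| "ring_arity RMinus = 1"
| "ring_arity RTimes = 2"

definition ring_signature :: "(ring_symbol, unit) signature" where
  "ring_signature = \<lparr> fun_arity = (\<lambda>s. Some (ring_arity s)), rel_arity = (\<lambda>_. None) \<rparr>"

fun ring_fint :: "('a, 'm) ring_scheme \<Rightarrow> ring_symbol \<Rightarrow> 'a list \<Rightarrow> 'a" where
  "ring_fint R RZero [] = \<zero>\<^bsub>R\<^esub>"
| "ring_fint R ROne [] = \<one>\<^bsub>R\<^esub>"
| "ring_fint R RPlus [x, y] = x \<oplus>\<^bsub>R\<^esub> y"
| "ring_fint R RMinus [x] = \<ominus>\<^bsub>R\<^esub> x"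
| "ring_fint R RTimes [x, y] = x \<otimes>\<^bsub>R\<^esub> y"

definition ring_struc :: "('a, 'm) ring_scheme \<Rightarrow> (ring_symbol, unit, 'a) struc" where
  "ring_struc R = \<lparr> univ = carrier R, fint = ring_fint R, rint = (\<lambda>_ _. False) \<rparr>"

datatype group_symbol = GOne | GInv | GTimes

fun group_arity :: "group_symbol \<Rightarrow> nat" where
  "group_arity GOne = 0"
| "group_arity GInv = 1"
| "group_arity GTimes = 2"

definition group_signature :: "(group_symbol, unit) signature" where
  "group_signature = \<lparr> fun_arity = (\<lambda>s. Some (group_arity s)), rel_arity = (\<lambda>_. None) \<rparr>"

fun group_fint :: "('a, 'm) monoid_scheme \<Rightarrow> group_symbol \<Rightarrow> 'a list \<Rightarrow> 'a" where
  "group_fint G GOne [] = \<one>\<^bsub>G\<^esub>"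
| "group_fint G GInv [x] = inv\<^bsub>G\<^esub> x"
| "group_fint G GTimes [x, y] = x \<otimes>\<^bsub>G\<^esub> y"

definition group_struc :: "('a, 'm) monoid_scheme \<Rightarrow> (group_symbol, unit, 'a) struc" where
  "group_struc G = \<lparr> univ = carrier G, fint = group_fint G, rint = (\<lambda>_ _. False) \<rparr>"


section \<open>Rings of integers of number fields\<close>

text \<open>A subfield, of finite degree over the rationals, of a field of characteristic 0.\<close>

definition number_field :: "'k::field_char_0 set \<Rightarrow> bool" where
  "number_field K \<longleftrightarrow>
     1 \<in> K \<and> (\<forall>x\<in>K. \<forall>y\<in>K. x - y \<in> K \<and> x * y \<in> K) \<and> (\<forall>x\<in>K. inverse x \<in> K) \<and>
     (\<exists>B. finite B \<and> B \<subseteq> K \<and> (\<forall>x\<in>K. \<exists>c. (\<forall>b\<in>B. c b \<in> \<rat>) \<and> x = (\<Sum>b\<in>B. c b * b)))"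

definition ring_of_integers :: "'k::field_char_0 set \<Rightarrow> 'k ring" where
  "ring_of_integers K =
     \<lparr> carrier = {x \<in> K. algebraic_int x}, mult = (*), one = 1, zero = 0, add = (+) \<rparr>"

text \<open>The family \<open>bs\<close> is a basis of the \<open>\<int>\<close>-module \<open>M\<close>.\<close>

definition free_Z_generators :: "'k::field_char_0 list \<Rightarrow> 'k set \<Rightarrow> bool" where
  "free_Z_generators bs M \<longleftrightarrow> set bs \<subseteq> M \<and>
     (\<forall>x\<in>M. \<exists>!c :: int list. length c = length bs \<and>
        x = (\<Sum>k<length bs. of_int (c ! k) * bs ! k))"


section \<open>Groups of triangular matrices\<close>

text \<open>Invertibility is over the ring: the inverse matrix also has entries in \<open>carrier R\<close>. Only rings
  \<open>R\<close> whose operations are those of the ambient type are considered.\<close>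

definition mats_over :: "nat \<Rightarrow> 'k::comm_ring_1 ring \<Rightarrow> 'k mat set" where
  "mats_over n R = {A \<in> carrier_mat n n. \<forall>i<n. \<forall>j<n. A $$ (i, j) \<in> carrier R}"

definition T_group :: "nat \<Rightarrow> 'k::comm_ring_1 ring \<Rightarrow> 'k mat monoid" where
  "T_group n R =
     \<lparr> carrier = {A \<in> mats_over n R. upper_triangular A \<and>
                    (\<exists>B \<in> mats_over n R. A * B = 1\<^sub>m n \<and> B * A = 1\<^sub>m n)},
       mult = (*), one = 1\<^sub>m n \<rparr>"

text \<open>Rows and columns are numbered from 0.\<close>

definition e_mat :: "nat \<Rightarrow> nat \<Rightarrow> nat \<Rightarrow> 'k::comm_ring_1 mat" where
  "e_mat n i j = mat n n (\<lambda>(r, s). if r = i \<and> s = j then 1 else 0)"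

definition t_mat :: "nat \<Rightarrow> nat \<Rightarrow> nat \<Rightarrow> 'k::comm_ring_1 \<Rightarrow> 'k mat" where
  "t_mat n i j \<beta> = 1\<^sub>m n + \<beta> \<cdot>\<^sub>m e_mat n i j"

definition d_mat :: "nat \<Rightarrow> nat \<Rightarrow> 'k::comm_ring_1 \<Rightarrow> 'k mat" where
  "d_mat n i \<alpha> = mat n n (\<lambda>(r, s). if r \<noteq> s then 0 else if r = i then \<alpha> else 1)"

definition t_params :: "nat \<Rightarrow> 'k::comm_ring_1 list \<Rightarrow> 'k mat set" where
  "t_params n bs = {t_mat n i j b | i j b. i < j \<and> j < n \<and> b \<in> set bs}"

definition d_params :: "nat \<Rightarrow> 'k::comm_ring_1 list \<Rightarrow> 'k mat set" where
  "d_params n as = {d_mat n i a | i a. i < n \<and> a \<in> set as}"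

end

theory Submission
  imports Defs "Jordan_Normal_Form.Char_Poly"
begin

text \<open>The group is interpreted in the ring by the \<open>n\<^sup>2\<close> entries of a matrix, and the ring in the group by
  \<open>x \<mapsto> t\<^bsub>1n\<^esub>(x)\<close>; addition is then multiplication in the group, and multiplication comes from the commutator
  formula \<open>[t\<^bsub>ik\<^esub>(x), t\<^bsub>kj\<^esub>(y)] = t\<^bsub>ij\<^esub>(xy)\<close>, which also links \<open>t\<^bsub>ij\<^esub>(x)\<close> to \<open>t\<^bsub>1n\<^esub>(x)\<close>.

  The point is to define the subgroup \<open>t\<^bsub>ij\<^esub>(\<O>)\<close> itself, and not only up to diagonal matrices. The matrices that commute
  with all \<open>d\<^sub>m(-1)\<close>, \<open>m \<notin> {i, j}\<close>, are the products of a diagonal matrix and some \<open>t\<^bsub>ij\<^esub>(x)\<close>. Their commutators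
  with \<open>d\<^sub>i(-1)\<close> form \<open>t\<^bsub>ij\<^esub>(2\<O>)\<close>, which has finite index in \<open>t\<^bsub>ij\<^esub>(\<O>)\<close> because \<open>\<O>\<close> is a finitely generated
  \<open>\<int>\<close>-module; and coset representatives are words in the parameters.

  Finally, the entries of a matrix are read off by writing it as a product of elementary matrices and a diagonal
  matrix. The diagonal matrices are finitely many, and each is a word in the parameters.\<close>

section \<open>Algebraic integers\<close>

text \<open>Conjugation by d_i(u) multiplies x by u, so a commutator with d_i(u) only gives
  multiples (u - 1)x. The units may be just 1 and -1, which leaves u = -1, and this is the origin of
  the number 2. Passing to commutators is what removes the unknown diagonal; the price is the index
  of 2\<O>, paid back by the coset representatives.

  The diagonal of a matrix is a separate obstacle: conjugation of elementary matrices shows only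
  quotients of diagonal entries and is blind to scalar matrices. A disjunction over all possible
  diagonals, finite because there are finitely many units, avoids the question.

  Both interpretations represent each element by exactly one tuple. Hence the composite isomorphisms
  are explicit: x goes to the entries of t_1n(x), and a matrix goes to the tuple of the t_1n(a), a
  running through its entries. Only the definability of these two graphs remains. It is derived from
  closure properties of predicates on environments instead of written-out formulas. Indices start at
  0 in the code, so t_1n(x) is \<open>\<tau> x\<close>.\<close>

definition int_span :: "'k::comm_ring_1 set \<Rightarrow> 'k set" where
  "int_span S = {x. \<exists>c :: 'k \<Rightarrow> int. x = (\<Sum>s\<in>S. of_int (c s) * s)}"

lemma int_span_add: "x \<in> int_span S \<Longrightarrow> y \<in> int_span S \<Longrightarrow> x + y \<in> int_span S"
proof -
  assume "x \<in> int_span S" "y \<in> int_span S"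
  then obtain c d :: "'a \<Rightarrow> int" where
    "x = (\<Sum>s\<in>S. of_int (c s) * s)" "y = (\<Sum>s\<in>S. of_int (d s) * s)"
    unfolding int_span_def by blast
  then have "x + y = (\<Sum>s\<in>S. of_int (c s + d s) * s)"
    by (simp add: sum.distrib algebra_simps)
  then show ?thesis unfolding int_span_def by (intro CollectI exI[of _ "\<lambda>s. c s + d s"])
qed

lemma int_span_of_int_mult: "x \<in> int_span S \<Longrightarrow> of_int k * x \<in> int_span S"
proof -
  assume "x \<in> int_span S"
  then obtain c :: "'a \<Rightarrow> int" where "x = (\<Sum>s\<in>S. of_int (c s) * s)"
    unfolding int_span_def by blast
  then have "of_int k * x = (\<Sum>s\<in>S. of_int (k * c s) * s)"
    by (simp add: sum_distrib_left mult.assoc)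
  then show ?thesis unfolding int_span_def by (intro CollectI exI[of _ "\<lambda>s. k * c s"])
qed

lemma int_span_sum: "(\<And>i. i \<in> I \<Longrightarrow> f i \<in> int_span S) \<Longrightarrow> (\<Sum>i\<in>I. f i) \<in> int_span S"
proof (induction I rule: infinite_finite_induct)
  case (insert i I)
  then show ?case by (simp add: int_span_add)
qed (auto simp: int_span_def intro!: exI[of _ "\<lambda>_. 0"])

lemma int_span_base: "finite S \<Longrightarrow> s \<in> S \<Longrightarrow> s \<in> int_span S"
  unfolding int_span_def
  by (intro CollectI exI[of _ "\<lambda>t. if t = s then 1 else 0"])
     (simp add: if_distrib[of of_int] if_distrib[of "\<lambda>u. u * _"] cong: if_cong)

lemma int_span_mult:
  assumes "\<And>s. s \<in> S \<Longrightarrow> z * s \<in> int_span S" "x \<in> int_span S"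
  shows "z * x \<in> int_span S"
proof -
  obtain c :: "'a \<Rightarrow> int" where "x = (\<Sum>s\<in>S. of_int (c s) * s)"
    using assms(2) unfolding int_span_def by blast
  then have "z * x = (\<Sum>s\<in>S. of_int (c s) * (z * s))"
    by (simp add: sum_distrib_left algebra_simps)
  then show ?thesis using assms(1) by (auto intro!: int_span_sum int_span_of_int_mult)
qed

text \<open>The elements of \<open>S\<close> form an eigenvector, with eigenvalue \<open>z\<close>, of an integer matrix.\<close>

lemma algebraic_int_if_stable:
  fixes z :: "'k::field_char_0"
  assumes S: "finite S" "s0 \<in> S" "s0 \<noteq> 0" and stable: "\<And>s. s \<in> S \<Longrightarrow> z * s \<in> int_span S"
  shows "algebraic_int z"
proof -
  define m where "m = card S"
  obtain w where w: "bij_betw w {..<m} S"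
    using S(1) ex_bij_betw_nat_finite[OF S(1)] unfolding m_def lessThan_atLeast0 by blast
  have "\<forall>s\<in>S. \<exists>c :: 'k \<Rightarrow> int. z * s = (\<Sum>t\<in>S. of_int (c t) * t)"
    using stable unfolding int_span_def by blast
  then obtain c :: "'k \<Rightarrow> 'k \<Rightarrow> int" where c: "\<And>s. s \<in> S \<Longrightarrow> z * s = (\<Sum>t\<in>S. of_int (c s t) * t)"
    by metis
  define B :: "int mat" where "B = mat m m (\<lambda>(i, j). c (w i) (w j))"
  define A :: "'k mat" where "A = map_mat of_int B"
  define v where "v = vec m w"
  have carr: "B \<in> carrier_mat m m" "A \<in> carrier_mat m m" "v \<in> carrier_vec m"
    by (auto simp: A_def B_def v_def)
  have "(A *\<^sub>v v) $ i = (z \<cdot>\<^sub>v v) $ i" if "i < m" for i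
  proof -
    have "w i \<in> S" using w that by (auto simp: bij_betw_def)
    then have "z * w i = (\<Sum>t\<in>S. of_int (c (w i) t) * t)" by (rule c)
    also have "\<dots> = (\<Sum>j<m. of_int (c (w i) (w j)) * w j)"
      by (rule sum.reindex_bij_betw[OF w, symmetric])
    finally show ?thesis
      using that by (simp add: A_def B_def v_def scalar_prod_def lessThan_atLeast0)
  qed
  then have Av: "A *\<^sub>v v = z \<cdot>\<^sub>v v" using carr by (intro eq_vecI) auto
  \<comment> \<open>The element \<open>s0\<close> is there to keep \<open>v\<close> from being the
    zero vector, as an eigenvector must be.\<close>
  obtain i0 where i0: "i0 < m" "w i0 = s0" using w S(2) by (auto simp: bij_betw_def image_def)
  have "v $ i0 \<noteq> 0\<^sub>v m $ i0" using i0 S(3) by (simp add: v_def)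
  then have "v \<noteq> 0\<^sub>v m" by auto
  then have "eigenvalue A z"
    unfolding eigenvalue_def eigenvector_def using carr Av by auto
  then have root: "poly (char_poly A) z = 0"
    using eigenvalue_root_char_poly[OF carr(2)] by blast
  \<comment> \<open>The characteristic polynomial is that of an integer matrix, hence monic with
    integer coefficients, and \<open>z\<close> is a root of it.\<close>
  have "char_poly A = map_poly of_int (char_poly B)"
    unfolding A_def by (rule of_int_hom.char_poly_hom[OF carr(1)])
  moreover have "lead_coeff (char_poly B) = 1"
    using degree_monic_char_poly[OF carr(1)] by simp
  ultimately show ?thesis
    using root unfolding algebraic_int_altdef_ipoly by auto
qed

lemma algebraic_int_power_reduction:
  fixes u :: "'k::field_char_0"
  assumes "algebraic_int u"
  obtains d :: nat and c :: "nat \<Rightarrow> int" where "d > 0" "u ^ d = (\<Sum>k<d. of_int (c k) * u ^ k)"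
proof -
  obtain p :: "int poly" where p: "poly (map_poly of_int p) u = 0" "lead_coeff p = 1"
    using assms unfolding algebraic_int_altdef_ipoly by blast
  define d where "d = degree p"
  have "poly (map_poly of_int p) u = (\<Sum>k\<le>d. of_int (coeff p k) * u ^ k)"
    by (simp add: poly_altdef d_def coeff_map_poly degree_map_poly)
  also have "\<dots> = (\<Sum>k<d. of_int (coeff p k) * u ^ k) + u ^ d"
    using p(2) by (simp add: d_def lessThan_Suc_atMost[symmetric])
  finally have e: "(\<Sum>k<d. of_int (coeff p k) * u ^ k) + u ^ d = 0" using p(1) by simp
  then have "u ^ d = (\<Sum>k<d. of_int (- coeff p k) * u ^ k)"
    by (simp add: sum_negf eq_neg_iff_add_eq_0 add.commute)
  \<comment> \<open>For \<open>d = 0\<close> the relation \<open>e\<close> would read 1 = 0.\<close>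
  moreover have "d > 0" using e by (cases d) auto
  ultimately show ?thesis by (intro that)
qed

text \<open>The monomials x^a y^b with a < d and b < d' span a \<int>-module that is stable under x
  and y: a product that leaves the range contains x^d or y^d', which the integral equation rewrites.
  So the module is also stable under x + y and x * y, and it contains 1.\<close>

lemma
  fixes x y :: "'k::field_char_0"
  assumes x: "algebraic_int x" and y: "algebraic_int y"
  shows algebraic_int_add: "algebraic_int (x + y)"
    and algebraic_int_mult: "algebraic_int (x * y)"
proof -
  obtain d :: nat and c :: "nat \<Rightarrow> int" where d: "d > 0" "x ^ d = (\<Sum>k<d. of_int (c k) * x ^ k)"
    by (rule algebraic_int_power_reduction[OF x])
  obtain d' :: nat and c' :: "nat \<Rightarrow> int" where d': "d' > 0" "y ^ d' = (\<Sum>k<d'. of_int (c' k) * y ^ k)"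
    by (rule algebraic_int_power_reduction[OF y])
  define S where "S = (\<lambda>(a, b). x ^ a * y ^ b) ` ({..<d} \<times> {..<d'})"
  have S: "finite S" unfolding S_def by simp
  have one: "1 \<in> S" unfolding S_def using d(1) d'(1) by (intro image_eqI[of _ _ "(0, 0)"]) auto
  have mem: "x ^ a * y ^ b \<in> int_span S" if "a < d" "b < d'" for a b
    using that by (intro int_span_base[OF S]) (auto simp: S_def)
  have xs: "x * s \<in> int_span S" if s: "s \<in> S" for s
  proof -
    obtain a b where ab: "a < d" "b < d'" "s = x ^ a * y ^ b" using s by (auto simp: S_def)
    show ?thesis
    proof (cases "Suc a < d")
      case True
      then show ?thesis using mem[of "Suc a" b] ab by (simp add: mult.assoc)
    next
      case False
      then have "d = Suc a" using ab by simp
      then have "x * s = x ^ d * y ^ b" using ab by (simp add: mult.assoc)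
      also have "\<dots> = (\<Sum>k<d. of_int (c k) * (x ^ k * y ^ b))"
        unfolding d(2) by (simp add: sum_distrib_right mult.assoc)
      finally show ?thesis using mem ab by (auto intro!: int_span_sum int_span_of_int_mult)
    qed
  qed
  have ys: "y * s \<in> int_span S" if s: "s \<in> S" for s
  proof -
    obtain a b where ab: "a < d" "b < d'" "s = x ^ a * y ^ b" using s by (auto simp: S_def)
    show ?thesis
    proof (cases "Suc b < d'")
      case True
      then show ?thesis using mem[of a "Suc b"] ab by (simp add: ac_simps)
    next
      case False
      then have "d' = Suc b" using ab by simp
      then have "y * s = x ^ a * y ^ d'" using ab by (simp add: ac_simps)
      also have "\<dots> = (\<Sum>k<d'. of_int (c' k) * (x ^ a * y ^ k))"
        unfolding d'(2) by (simp add: sum_distrib_left ac_simps)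
      finally show ?thesis using mem ab by (auto intro!: int_span_sum int_span_of_int_mult)
    qed
  qed
  show "algebraic_int (x + y)"
  proof (rule algebraic_int_if_stable[OF S one one_neq_zero])
    show "(x + y) * s \<in> int_span S" if "s \<in> S" for s
      using int_span_add[OF xs[OF that] ys[OF that]] by (simp add: distrib_right)
  qed
  show "algebraic_int (x * y)"
  proof (rule algebraic_int_if_stable[OF S one one_neq_zero])
    show "x * y * s \<in> int_span S" if "s \<in> S" for s
      using int_span_mult[OF xs ys[OF that]] by (simp add: mult.assoc)
  qed
qed

section \<open>Definable relations and functions\<close>

fun rename_term :: "(nat \<Rightarrow> nat) \<Rightarrow> 'f fo_term \<Rightarrow> 'f fo_term" where
  "rename_term r (Variable i) = Variable (r i)"
| "rename_term r (Apply f ts) = Apply f (map (rename_term r) ts)"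

fun rename :: "(nat \<Rightarrow> nat) \<Rightarrow> ('f, 'r) formula \<Rightarrow> ('f, 'r) formula" where
  "rename r (Equal s t) = Equal (rename_term r s) (rename_term r t)"
| "rename r (Related q ts) = Related q (map (rename_term r) ts)"
| "rename r (Negation p) = Negation (rename r p)"
| "rename r (Conjunction p q) = Conjunction (rename r p) (rename r q)"
| "rename r (Exists p) = Exists (rename (case_nat 0 (\<lambda>i. Suc (r i))) p)"

lemma wf_rename_term: "wf_term L n t \<Longrightarrow> (\<And>i. i < n \<Longrightarrow> r i < m) \<Longrightarrow> wf_term L m (rename_term r t)"
  by (induction t) auto

lemma eval_rename_term: "eval_term M e (rename_term r t) = eval_term M (\<lambda>i. e (r i)) t"
proof (induction t)
  case (Apply f ts)
  then have "map (eval_term M e \<circ> rename_term r) ts = map (eval_term M (\<lambda>i. e (r i))) ts" by simp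
  then show ?case by (simp only: rename_term.simps eval_term.simps map_map)
qed simp

lemma wf_rename: "wf_formula L n p \<Longrightarrow> (\<And>i. i < n \<Longrightarrow> r i < m) \<Longrightarrow> wf_formula L m (rename r p)"
proof (induction p arbitrary: n m r)
  case (Exists p)
  show ?case using Exists.prems
    by (auto intro!: Exists.IH[of "Suc n"] split: nat.split)
qed (auto intro: wf_rename_term)

lemma sat_rename: "sat M e (rename r p) \<longleftrightarrow> sat M (\<lambda>i. e (r i)) p"
proof (induction p arbitrary: e r)
  case (Related q ts)
  then show ?case by (simp add: eval_rename_term comp_def)
next
  case (Exists p)
  have "(\<lambda>i. case_nat a e (case_nat 0 (\<lambda>i. Suc (r i)) i)) = case_nat a (\<lambda>i. e (r i))" for a
    by (auto split: nat.split)
  then show ?case by (simp add: Exists.IH)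
qed (simp_all add: eval_rename_term)

text \<open>The environment that \<open>definable\<close> produces: the arguments first, then the
  parameters. Values beyond the last parameter are junk that well-formed formulas never
  read.\<close>

definition with_params :: "'a list \<Rightarrow> nat \<Rightarrow> (nat \<Rightarrow> 'a) \<Rightarrow> nat \<Rightarrow> 'a" where
  "with_params ps k e = (\<lambda>i. if i < k then e i else ps ! (i - k))"

lemma nth_append_params: "(!) (xs @ ps) = with_params ps (length xs) ((!) xs)"
  by (auto simp: with_params_def nth_append)

text \<open>A \<open>struc\<close> does not promise that its functions stay inside the universe.
  This is required to treat function symbols as definable functions and to transport satisfaction
  along isomorphisms.\<close>

definition closed_struc :: "('f, 'r) signature \<Rightarrow> ('f, 'r, 'a) struc \<Rightarrow> bool" where
  "closed_struc L M \<longleftrightarrow> (\<forall>f k. fun_arity L f = Some k \<longrightarrow> (\<forall>xs \<in> tuples M k. fint M f xs \<in> univ M))"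

text \<open>A relation between the values \<open>e 0, \<dots>, e (k - 1)\<close> is given as a predicate on environments.
  Unlike in \<^const>\<open>definable\<close>, the list of parameters is fixed, since all formulas of an
  interpretation have to share it.\<close>

locale struc_with_params =
  fixes L :: "('f, 'r) signature" and M :: "('f, 'r, 'a) struc" and ps :: "'a list"
  assumes params: "set ps \<subseteq> univ M" and closed: "closed_struc L M"
begin

text \<open>Agreement is demanded only when the first \<open>k\<close> values lie in the universe,
  so \<open>R\<close> may be any HOL predicate and can behave arbitrarily elsewhere.\<close>

definition dfn :: "nat \<Rightarrow> ((nat \<Rightarrow> 'a) \<Rightarrow> bool) \<Rightarrow> bool" where
  "dfn k R \<longleftrightarrow> (\<exists>p. wf_formula L (k + length ps) p \<and>
     (\<forall>e. (\<forall>i<k. e i \<in> univ M) \<longrightarrow> (sat M (with_params ps k e) p \<longleftrightarrow> R e)))"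

lemma dfnI:
  assumes "wf_formula L (k + length ps) p"
    and "\<And>e. (\<And>i. i < k \<Longrightarrow> e i \<in> univ M) \<Longrightarrow> sat M (with_params ps k e) p \<longleftrightarrow> R e"
  shows "dfn k R"
  using assms unfolding dfn_def by blast

lemma dfn_cong:
  assumes "\<And>e. (\<And>i. i < k \<Longrightarrow> e i \<in> univ M) \<Longrightarrow> R e \<longleftrightarrow> R' e" and "dfn k R'"
  shows "dfn k R"
  using assms unfolding dfn_def by auto

text \<open>A defining formula sees the environment only through \<open>with_params\<close>, which
  forgets everything from position \<open>k\<close> on.\<close>

lemma dfn_local:
  assumes "dfn k R" "\<And>i. i < k \<Longrightarrow> e i \<in> univ M" "\<And>i. i < k \<Longrightarrow> e i = e' i"
  shows "R e \<longleftrightarrow> R e'"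
proof -
  have "with_params ps k e = with_params ps k e'" using assms(3) by (auto simp: with_params_def)
  then show ?thesis using assms unfolding dfn_def by metis
qed

lemma dfn_not: "dfn k R \<Longrightarrow> dfn k (\<lambda>e. \<not> R e)"
  unfolding dfn_def by (elim exE, rule_tac x = "Negation p" in exI) auto

lemma dfn_conj: "dfn k R \<Longrightarrow> dfn k S \<Longrightarrow> dfn k (\<lambda>e. R e \<and> S e)"
  unfolding dfn_def by (elim exE, rule_tac x = "Conjunction p pa" in exI) auto

lemma dfn_rename:
  assumes "dfn k R" "\<And>i. i < k \<Longrightarrow> r i < k'"
  shows "dfn k' (\<lambda>e. R (\<lambda>i. e (r i)))"
proof -
  obtain p where p: "wf_formula L (k + length ps) p"
    "\<And>e. (\<forall>i<k. e i \<in> univ M) \<Longrightarrow> sat M (with_params ps k e) p \<longleftrightarrow> R e"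
    using assms(1) unfolding dfn_def by blast
  \<comment> \<open>The parameters sit behind the arguments, so they have to move from position
    \<open>k\<close> to position \<open>k'\<close>.\<close>
  let ?r = "\<lambda>i. if i < k then r i else i - k + k'"
  show ?thesis
  proof (rule dfnI)
    show "wf_formula L (k' + length ps) (rename ?r p)"
      using assms(2) by (intro wf_rename[OF p(1)]) (auto simp: trans_less_add1)
    fix e :: "nat \<Rightarrow> 'a" assume e: "\<And>i. i < k' \<Longrightarrow> e i \<in> univ M"
    have "with_params ps k' e (?r i) = with_params ps k (\<lambda>i. e (r i)) i" for i
    proof (cases "i < k")
      case False
      then obtain d where "i = k + d" by (auto simp: not_less dest: le_Suc_ex)
      then show ?thesis by (simp add: with_params_def)
    qed (simp add: with_params_def assms(2))
    then have "(\<lambda>i. with_params ps k' e (?r i)) = with_params ps k (\<lambda>i. e (r i))" by blast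
    then show "sat M (with_params ps k' e) (rename ?r p) \<longleftrightarrow> R (\<lambda>i. e (r i))"
      using p(2)[of "\<lambda>i. e (r i)"] e assms(2) by (simp add: sat_rename)
  qed
qed

lemma dfn_ex:
  assumes "dfn (Suc k) (\<lambda>e. R (e 0) (\<lambda>i. e (Suc i)))"
  shows "dfn k (\<lambda>e. \<exists>a \<in> univ M. R a e)"
proof -
  obtain p where p: "wf_formula L (Suc k + length ps) p"
    "\<And>e. (\<forall>i<Suc k. e i \<in> univ M) \<Longrightarrow>
       sat M (with_params ps (Suc k) e) p \<longleftrightarrow> R (e 0) (\<lambda>i. e (Suc i))"
    using assms unfolding dfn_def by blast
  show ?thesis
  proof (rule dfnI)
    show "wf_formula L (k + length ps) (Exists p)" using p(1) by simp
    fix e :: "nat \<Rightarrow> 'a" assume e: "\<And>i. i < k \<Longrightarrow> e i \<in> univ M"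
    have "case_nat a (with_params ps k e) = with_params ps (Suc k) (case_nat a e)" for a
      by (auto simp: with_params_def split: nat.split)
    then have "sat M (case_nat a (with_params ps k e)) p \<longleftrightarrow> R a e" if "a \<in> univ M" for a
      using p(2)[of "case_nat a e"] e that by (simp split: nat.split)
    then show "sat M (with_params ps k e) (Exists p) \<longleftrightarrow> (\<exists>a \<in> univ M. R a e)" by auto
  qed
qed

text \<open>A block of quantifiers, used later to quantify over all entries of an inverse
  matrix.\<close>

lemma dfn_ex_many:
  "dfn (m + k) R \<Longrightarrow>
     dfn k (\<lambda>e. \<exists>y. (\<forall>i<m. y i \<in> univ M) \<and> R (\<lambda>i. if i < m then y i else e (i - m)))"
proof (induction m arbitrary: k R)
  case 0
  then show ?case by simp
next
  case (Suc m)
  \<comment> \<open>\<open>S\<close> quantifies the first \<open>m\<close> values and reads value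
    number \<open>m\<close> from its variable 0; this is why the induction generalizes over
    \<open>k\<close>. A single quantifier over variable 0 then finishes the block.\<close>
  define S where "S e \<longleftrightarrow>
      (\<exists>y. (\<forall>i<m. y i \<in> univ M) \<and> R (\<lambda>i. if i < m then y i else e (i - m)))" for e
  have S: "dfn (Suc k) S" unfolding S_def using Suc.prems by (intro Suc.IH) simp
  have "dfn k (\<lambda>e. \<exists>a \<in> univ M. S (case_nat a e))"
  proof (rule dfn_ex)
    have "case_nat (e 0) (\<lambda>i. e (Suc i)) = e" for e :: "nat \<Rightarrow> 'a" by (auto split: nat.split)
    then show "dfn (Suc k) (\<lambda>e. S (case_nat (e 0) (\<lambda>i. e (Suc i))))" using S by simp
  qed
  moreover have "(\<exists>y. (\<forall>i<Suc m. y i \<in> univ M) \<and> R (\<lambda>i. if i < Suc m then y i else e (i - Suc m)))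
      \<longleftrightarrow> (\<exists>a \<in> univ M. S (case_nat a e))" (is "?L \<longleftrightarrow> ?R") for e
  proof
    assume ?L
    then obtain y where
      y: "\<forall>i<Suc m. y i \<in> univ M" "R (\<lambda>i. if i < Suc m then y i else e (i - Suc m))"
      by blast
    have "(if i < m then y i else case_nat (y m) e (i - m)) =
        (if i < Suc m then y i else e (i - Suc m))" for i
      by (cases i m rule: linorder_cases) (auto dest!: less_imp_Suc_add)
    then show ?R using y unfolding S_def by (intro bexI[of _ "y m"] exI[of _ y]) auto
  next
    assume ?R
    then obtain a y where y: "a \<in> univ M" "\<forall>i<m. y i \<in> univ M"
      "R (\<lambda>i. if i < m then y i else case_nat a e (i - m))"
      unfolding S_def by blast
    have "(if i < m then y i else case_nat a e (i - m)) =
        (if i < Suc m then (y(m := a)) i else e (i - Suc m))" for i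
      by (cases i m rule: linorder_cases) (auto dest!: less_imp_Suc_add)
    then show ?L using y by (intro exI[of _ "y(m := a)"]) (auto simp: less_Suc_eq)
  qed
  ultimately show ?case by simp
qed

text \<open>Functions are given by their graphs, with the value as variable 0, because no term need
  exist for them. The closure condition ensures that the value is found by a quantifier over the
  universe, which is how \<open>dfn_subst\<close> works.\<close>

definition dfun :: "nat \<Rightarrow> ((nat \<Rightarrow> 'a) \<Rightarrow> 'a) \<Rightarrow> bool" where
  "dfun k F \<longleftrightarrow> (\<forall>e. (\<forall>i<k. e i \<in> univ M) \<longrightarrow> F e \<in> univ M) \<and>
     dfn (Suc k) (\<lambda>e. e 0 = F (\<lambda>i. e (Suc i)))"

lemma dfun_closed: "dfun k F \<Longrightarrow> (\<And>i. i < k \<Longrightarrow> e i \<in> univ M) \<Longrightarrow> F e \<in> univ M"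
  unfolding dfun_def by blast

lemma dfun_rename:
  assumes "dfun k F" "\<And>i. i < k \<Longrightarrow> r i < k'"
  shows "dfun k' (\<lambda>e. F (\<lambda>i. e (r i)))"
proof -
  have "dfn (Suc k') (\<lambda>e. e (case_nat 0 (\<lambda>i. Suc (r i)) 0) =
      F (\<lambda>i. e (case_nat 0 (\<lambda>i. Suc (r i)) (Suc i))))"
  proof (rule dfn_rename[of "Suc k" "\<lambda>e. e 0 = F (\<lambda>i. e (Suc i))"])
    show "dfn (Suc k) (\<lambda>e. e 0 = F (\<lambda>i. e (Suc i)))" using assms(1) unfolding dfun_def by blast
    show "case_nat 0 (\<lambda>i. Suc (r i)) i < Suc k'" if "i < Suc k" for i
      using assms(2) that by (cases i) auto
  qed
  moreover have "F (\<lambda>i. e (r i)) \<in> univ M" if "\<forall>i<k'. e i \<in> univ M" for e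
    by (rule dfun_closed[OF assms(1)]) (use assms(2) that in simp)
  ultimately show ?thesis unfolding dfun_def by simp
qed

lemma dfn_subst:
  assumes "dfun k F" "dfn (Suc k) (\<lambda>e. R (e 0) (\<lambda>i. e (Suc i)))"
  shows "dfn k (\<lambda>e. R (F e) e)"
proof (rule dfn_cong)
  show "dfn k (\<lambda>e. \<exists>a \<in> univ M. a = F e \<and> R a e)"
    using assms unfolding dfun_def by (intro dfn_ex dfn_conj) auto
  show "R (F e) e \<longleftrightarrow> (\<exists>a \<in> univ M. a = F e \<and> R a e)" if "\<And>i. i < k \<Longrightarrow> e i \<in> univ M" for e
    using dfun_closed[OF assms(1) that] by auto
qed

text \<open>Simultaneous substitution, carried out one variable at a time. The original environment
  is kept behind the \<open>m\<close> substituted values, since every \<open>F i\<close> still has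
  to read it.\<close>

lemma dfn_comp_aux:
  "dfn (m + k) R \<Longrightarrow> (\<And>i. i < m \<Longrightarrow> dfun k (F i)) \<Longrightarrow>
     dfn k (\<lambda>e. R (\<lambda>i. if i < m then F i e else e (i - m)))"
proof (induction m arbitrary: k F)
  case 0
  then show ?case by simp
next
  case (Suc m)
  \<comment> \<open>Position \<open>m\<close> is held open as variable 0, so the functions already
    substituted read an environment shifted by one. \<open>dfn_subst\<close> then fills the open
    position with \<open>F m\<close>.\<close>
  have "dfn (Suc k) (\<lambda>e. R (\<lambda>i. if i < m then F i (\<lambda>j. e (Suc j)) else e (i - m)))"
  proof (rule Suc.IH)
    show "dfn (m + Suc k) R" using Suc.prems(1) by simp
    show "dfun (Suc k) (\<lambda>e. F i (\<lambda>j. e (Suc j)))" if "i < m" for i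
      using Suc.prems(2)[of i] that by (intro dfun_rename[of k "F i" Suc]) auto
  qed
  moreover have "(\<lambda>i. if i < m then F i (\<lambda>j. e (Suc j)) else e (i - m)) =
      (\<lambda>i. if i < m then F i (\<lambda>j. e (Suc j)) else if i = m then e 0 else e (Suc (i - Suc m)))" for e
  proof
    show "(if i < m then F i (\<lambda>j. e (Suc j)) else e (i - m)) =
      (if i < m then F i (\<lambda>j. e (Suc j)) else if i = m then e 0 else e (Suc (i - Suc m)))" for i
      by (cases i m rule: linorder_cases) (simp_all add: Suc_diff_Suc)
  qed
  ultimately have "dfn (Suc k) (\<lambda>e. R (\<lambda>i. if i < m then F i (\<lambda>j. e (Suc j)) else
      if i = m then e 0 else e (Suc (i - Suc m))))" by simp
  then have "dfn k (\<lambda>e. R (\<lambda>i. if i < m then F i e else if i = m then F m e else e (i - Suc m)))"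
    using Suc.prems(2)[of m]
    by (intro dfn_subst[where R = "\<lambda>a e. R (\<lambda>i. if i < m then F i e else
          if i = m then a else e (i - Suc m))"]) simp_all
  moreover have "(\<lambda>i. if i < m then F i e else if i = m then F m e else e (i - Suc m)) =
      (\<lambda>i. if i < Suc m then F i e else e (i - Suc m))" for e
    by (auto simp: fun_eq_iff less_Suc_eq)
  ultimately show ?case by simp
qed

lemma dfn_comp:
  assumes "dfn m R" "\<And>i. i < m \<Longrightarrow> dfun k (F i)"
  shows "dfn k (\<lambda>e. R (\<lambda>i. F i e))"
proof -
  have R: "dfn (m + k) R" using dfn_rename[OF assms(1), of "\<lambda>i. i" "m + k"] by simp
  have "dfn k (\<lambda>e. R (\<lambda>i. if i < m then F i e else e (i - m)))"
    by (rule dfn_comp_aux[OF R assms(2)])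
  then show ?thesis
    by (rule dfn_cong[rotated]) (rule dfn_local[OF assms(1)], auto intro: dfun_closed assms(2))
qed

lemma dfun_var: "i < k \<Longrightarrow> dfun k (\<lambda>e. e i)"
  unfolding dfun_def
  by (auto intro!: dfnI[of _ "Equal (Variable 0) (Variable (Suc i))"] simp: with_params_def)

lemma dfun_comp:
  assumes F: "dfun m F" and G: "\<And>i. i < m \<Longrightarrow> dfun k (G i)"
  shows "dfun k (\<lambda>e. F (\<lambda>i. G i e))"
proof -
  \<comment> \<open>Adding the value variable as component 0 turns the graph of the composite into
    one substitution of \<open>Suc m\<close> functions into the graph of \<open>F\<close>.\<close>
  define H where "H i = (\<lambda>e. case i of 0 \<Rightarrow> e 0 | Suc j \<Rightarrow> G j (\<lambda>l. e (Suc l)))" for i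
  have "dfun (Suc k) (H i)" if "i < Suc m" for i
  proof (cases i)
    case 0
    then show ?thesis unfolding H_def using dfun_var[of 0 "Suc k"] by simp
  next
    case (Suc j)
    then show ?thesis unfolding H_def using dfun_rename[OF G, of j Suc "Suc k"] that by simp
  qed
  then have "dfn (Suc k) (\<lambda>e. H 0 e = F (\<lambda>i. H (Suc i) e))"
    using F dfn_comp[of "Suc m" "\<lambda>e. e 0 = F (\<lambda>i. e (Suc i))" "Suc k" H]
    unfolding dfun_def[of m] by blast
  then have "dfn (Suc k) (\<lambda>e. e 0 = F (\<lambda>i. G i (\<lambda>l. e (Suc l))))" by (simp add: H_def)
  moreover have "F (\<lambda>i. G i e) \<in> univ M" if "\<forall>i<k. e i \<in> univ M" for e
    by (rule dfun_closed[OF F], rule dfun_closed[OF G]) (use that in simp_all)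
  ultimately show ?thesis unfolding dfun_def by simp
qed

lemma dfun_param: "c \<in> set ps \<Longrightarrow> dfun k (\<lambda>e. c)"
proof -
  assume "c \<in> set ps"
  then obtain j where j: "j < length ps" "c = ps ! j" by (auto simp: in_set_conv_nth)
  then have "dfn (Suc k) (\<lambda>e. e 0 = c)"
    by (intro dfnI[of _ "Equal (Variable 0) (Variable (Suc k + j))"]) (auto simp: with_params_def)
  then show ?thesis using \<open>c \<in> set ps\<close> params unfolding dfun_def by auto
qed

lemma dfun_fint:
  assumes "fun_arity L f = Some m" "\<And>i. i < m \<Longrightarrow> dfun k (F i)"
  shows "dfun k (\<lambda>e. fint M f (map (\<lambda>i. F i e) [0..<m]))"
proof (rule dfun_comp[of m "\<lambda>e. fint M f (map e [0..<m])"])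
  let ?p = "Equal (Variable 0) (Apply f (map (\<lambda>i. Variable (Suc i)) [0..<m]))"
  have "dfn (Suc m) (\<lambda>e. e 0 = fint M f (map (\<lambda>i. e (Suc i)) [0..<m]))"
  proof (rule dfnI)
    show "wf_formula L (Suc m + length ps) ?p" using assms(1) by auto
    have "map (eval_term M (with_params ps (Suc m) e) \<circ> (\<lambda>i. Variable (Suc i))) [0..<m] =
        map (\<lambda>i. e (Suc i)) [0..<m]" for e
      by (auto simp: with_params_def)
    then show "sat M (with_params ps (Suc m) e) ?p \<longleftrightarrow>
        e 0 = fint M f (map (\<lambda>i. e (Suc i)) [0..<m])" for e
      by (simp add: with_params_def del: map_eq_conv)
  qed
  moreover have "fint M f (map e [0..<m]) \<in> univ M" if "\<forall>i<m. e i \<in> univ M" for e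
  proof -
    have "map e [0..<m] \<in> tuples M m" using that by (auto simp: tuples_def)
    then show ?thesis using closed assms(1) unfolding closed_struc_def by blast
  qed
  ultimately show "dfun m (\<lambda>e. fint M f (map e [0..<m]))" unfolding dfun_def by simp
qed (rule assms(2))

lemma dfn_eq:
  assumes "dfun k F" "dfun k G"
  shows "dfn k (\<lambda>e. F e = G e)"
proof (rule dfn_comp[of 2 "\<lambda>e. e 0 = e 1" k "\<lambda>i. if i = 0 then F else G", simplified])
  show "dfn 2 (\<lambda>e. e 0 = e (Suc 0))"
    by (rule dfnI[of _ "Equal (Variable 0) (Variable (Suc 0))"]) (auto simp: with_params_def)
qed (simp add: assms)

lemma dfn_comp1: "dfn 1 (\<lambda>e. P (e 0)) \<Longrightarrow> dfun k F \<Longrightarrow> dfn k (\<lambda>e. P (F e))"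
  using dfn_comp[of 1 "\<lambda>e. P (e 0)" k "\<lambda>_. F"] by simp

lemma dfn_comp2:
  assumes "dfn 2 (\<lambda>e. P (e 0) (e 1))" "dfun k F" "dfun k G"
  shows "dfn k (\<lambda>e. P (F e) (G e))"
  using dfn_comp[OF assms(1), of k "\<lambda>i. if i = 0 then F else G"] assms(2,3) by simp

lemma dfn_comp3:
  assumes "dfn 3 (\<lambda>e. P (e 0) (e 1) (e 2))" "dfun k F" "dfun k G" "dfun k H"
  shows "dfn k (\<lambda>e. P (F e) (G e) (H e))"
  using dfn_comp[OF assms(1), of k "\<lambda>i. if i = 0 then F else if i = 1 then G else H"] assms(2-4)
  by simp

lemma dfn_bool: "dfn k (\<lambda>e. B)"
proof -
  \<comment> \<open>A closed formula, so that the tautology built from it is well-formed even with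
    no variables and no parameters at hand.\<close>
  let ?p = "Exists (Equal (Variable 0) (Variable 0))"
  have T: "dfn k (\<lambda>e. True)"
    by (rule dfnI[of _ "Negation (Conjunction (Negation ?p) ?p)"]) auto
  show ?thesis using T dfn_not[OF T] by (cases B) auto
qed

lemma dfn_disj: "dfn k R \<Longrightarrow> dfn k S \<Longrightarrow> dfn k (\<lambda>e. R e \<or> S e)"
  using dfn_not[of k "\<lambda>e. \<not> R e \<and> \<not> S e"] by (simp add: dfn_conj dfn_not)

lemma dfn_imp: "dfn k R \<Longrightarrow> dfn k S \<Longrightarrow> dfn k (\<lambda>e. R e \<longrightarrow> S e)"
  unfolding imp_conv_disj by (rule dfn_disj, rule dfn_not)

lemma dfn_if: "(B \<Longrightarrow> dfn k R) \<Longrightarrow> (\<not> B \<Longrightarrow> dfn k S) \<Longrightarrow> dfn k (\<lambda>e. if B then R e else S e)"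
  by (cases B) simp_all

lemma dfn_ball: "finite I \<Longrightarrow> (\<And>i. i \<in> I \<Longrightarrow> dfn k (R i)) \<Longrightarrow> dfn k (\<lambda>e. \<forall>i\<in>I. R i e)"
  by (induction I rule: finite_induct) (simp_all add: dfn_bool dfn_conj)

lemma dfn_bex: "finite I \<Longrightarrow> (\<And>i. i \<in> I \<Longrightarrow> dfn k (R i)) \<Longrightarrow> dfn k (\<lambda>e. \<exists>i\<in>I. R i e)"
  by (induction I rule: finite_induct) (simp_all add: dfn_bool dfn_disj)

lemma dfn_all_less: "(\<And>i. i < (m::nat) \<Longrightarrow> dfn k (R i)) \<Longrightarrow> dfn k (\<lambda>e. \<forall>i<m. R i e)"
  using dfn_ball[of "{..<m}" k R] by (simp add: Ball_def)

lemma dfn_formula: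
  assumes "dfn k R"
  shows "\<exists>p. wf_formula L (k + length ps) p \<and>
    (\<forall>xs \<in> tuples M k. sat_list M (xs @ ps) p \<longleftrightarrow> R ((!) xs))"
proof -
  obtain p where p: "wf_formula L (k + length ps) p"
    "\<And>e. (\<forall>i<k. e i \<in> univ M) \<Longrightarrow> sat M (with_params ps k e) p \<longleftrightarrow> R e"
    using assms unfolding dfn_def by blast
  have "sat_list M (xs @ ps) p \<longleftrightarrow> R ((!) xs)" if "xs \<in> tuples M k" for xs
  proof -
    have "length xs = k" "\<forall>i<k. xs ! i \<in> univ M" using that by (auto simp: tuples_def)
    then show ?thesis using p(2)[of "(!) xs"] by (simp add: nth_append_params)
  qed
  then show ?thesis using p(1) by blast
qed

lemma definable_if_dfn:
  assumes "dfn k R" "set ps \<subseteq> P" "X \<subseteq> tuples M k" "\<And>xs. xs \<in> tuples M k \<Longrightarrow> xs \<in> X \<longleftrightarrow> R ((!) xs)"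
  shows "definable L M P k X"
proof -
  obtain p where p: "wf_formula L (k + length ps) p"
    "\<forall>xs \<in> tuples M k. sat_list M (xs @ ps) p \<longleftrightarrow> R ((!) xs)"
    using dfn_formula[OF assms(1)] by blast
  then have "X = {xs \<in> tuples M k. sat_list M (xs @ ps) p}" using assms(3,4) by blast
  then show ?thesis unfolding definable_def using p(1) assms(2) by blast
qed

end

section \<open>Interpretations with trivial equivalence\<close>

text \<open>The interpretation \<open>I\<close> represents \<open>a\<close> in the universe of \<open>A\<close> by the single tuple \<open>h a\<close>.\<close>

definition codes ::
  "('f, 'r) signature \<Rightarrow> ('f, 'r, 'a) struc \<Rightarrow> ('g, 's) signature \<Rightarrow> ('g, 's, 'b) struc \<Rightarrow> 'b list \<Rightarrow>
   ('f, 'r, 'g, 's) interp \<Rightarrow> ('a \<Rightarrow> 'b list) \<Rightarrow> bool" where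
  "codes L A L' B ps I h \<longleftrightarrow>
     rel_arity L = (\<lambda>_. None) \<and> closed_struc L A \<and> closed_struc L' B \<and> set ps \<subseteq> univ B \<and>
     wf_interp L L' I (length ps) \<and> inj_on h (univ A) \<and> dom_tuples I B ps = h ` univ A \<and>
     (\<forall>a \<in> univ A. \<forall>b \<in> univ A. sat_list B (h a @ h b @ ps) (interp_eq I) \<longleftrightarrow> a = b) \<and>
     (\<forall>f k. fun_arity L f = Some k \<longrightarrow> (\<forall>as \<in> tuples A k. \<forall>b \<in> univ A.
        sat_list B (concat (map h as) @ h b @ ps) (interp_fun I f) \<longleftrightarrow> fint A f as = b))"

lemma codes_tuples:
  assumes "codes L A L' B ps I h" "a \<in> univ A"
  shows "h a \<in> tuples B (interp_dim I)"
proof -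
  have "h a \<in> dom_tuples I B ps" using assms unfolding codes_def by auto
  then show ?thesis unfolding dom_tuples_def by auto
qed

lemma codes_eq_tuples:
  assumes "codes L A L' B ps I h"
  shows "eq_tuples I B ps = Id_on (h ` univ A)"
  using assms unfolding codes_def eq_tuples_def by (auto simp: Id_on_def inj_on_def)

lemma codes_class:
  assumes "codes L A L' B ps I h" "a \<in> univ A"
  shows "eq_tuples I B ps `` {h a} = {h a}"
  using assms(2) unfolding codes_eq_tuples[OF assms(1)] by auto

lemma codes_univ:
  assumes "codes L A L' B ps I h"
  shows "univ (interpreted_struc I B ps) = (\<lambda>a. {h a}) ` univ A"
proof -
  have "dom_tuples I B ps = h ` univ A" using assms unfolding codes_def by blast
  then show ?thesis
    unfolding interpreted_struc_def quotient_def codes_eq_tuples[OF assms] by auto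
qed

lemma list_all2_singletons: "list_all2 (\<in>) xss (map (\<lambda>a. {h a}) as) \<longleftrightarrow> xss = map h as"
  by (induction as arbitrary: xss) (auto simp: list_all2_Cons2)

lemma codes_interpreted_fun:
  assumes I: "codes L A L' B ps I h" and "fun_arity L f = Some k" "as \<in> tuples A k" "b \<in> univ A"
  shows "interpreted_fun I B ps f (map (\<lambda>a. {h a}) as) {h b} \<longleftrightarrow> fint A f as = b"
proof -
  have "interpreted_fun I B ps f (map (\<lambda>a. {h a}) as) {h b} \<longleftrightarrow>
      sat_list B (concat (map h as) @ h b @ ps) (interp_fun I f)"
    unfolding interpreted_fun_def list_all2_singletons by simp
  then show ?thesis using assms unfolding codes_def by blast
qed

lemma codes_tuples_interpreted:
  assumes "codes L A L' B ps I h" "Xs \<in> tuples (interpreted_struc I B ps) k"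
  obtains as where "as \<in> tuples A k" "Xs = map (\<lambda>a. {h a}) as"
proof -
  have "set Xs \<subseteq> (\<lambda>a. {h a}) ` univ A" and len: "length Xs = k"
    using assms(2) codes_univ[OF assms(1)] by (auto simp: tuples_def)
  then have "Xs \<in> lists ((\<lambda>a. {h a}) ` univ A)" by (auto simp: in_lists_conv_set)
  then obtain as where "as \<in> lists (univ A)" "Xs = map (\<lambda>a. {h a}) as"
    unfolding lists_image by blast
  then show ?thesis using that[of as] len by (auto simp: tuples_def)
qed

lemma codes_fint_closed:
  assumes "codes L A L' B ps I h" "fun_arity L f = Some k" "as \<in> tuples A k"
  shows "fint A f as \<in> univ A"
  using assms unfolding codes_def closed_struc_def by blast

lemma codes_inj:
  assumes "codes L A L' B ps I h"
  shows "inj_on (\<lambda>a. {h a}) (univ A)"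
  using assms unfolding codes_def inj_on_def by auto

text \<open>All classes are singletons, so every formula respects the equivalence, and unique
  existence of values is inherited from \<open>fint A\<close>.\<close>

lemma codes_interpretation:
  assumes I: "codes L A L' B ps I h"
  shows "interpretation_in L I L' B ps"
proof -
  have equiv: "equiv (dom_tuples I B ps) (eq_tuples I B ps)"
  proof -
    have "dom_tuples I B ps = h ` univ A" using I unfolding codes_def by blast
    then show ?thesis
      unfolding codes_eq_tuples[OF I] by (auto intro!: equivI simp: refl_on_def sym_def trans_def)
  qed
  have "xss = yss" if "list_all2 (\<lambda>xs ys. (xs, ys) \<in> eq_tuples I B ps) xss yss" for xss yss
    using that unfolding codes_eq_tuples[OF I] by (induction rule: list_all2_induct) auto
  moreover have "\<exists>!Y. Y \<in> univ (interpreted_struc I B ps) \<and> interpreted_fun I B ps f Xs Y"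
    if f: "fun_arity L f = Some k" and Xs: "Xs \<in> tuples (interpreted_struc I B ps) k" for f k Xs
  proof -
    obtain as where as: "as \<in> tuples A k" "Xs = map (\<lambda>a. {h a}) as"
      by (rule codes_tuples_interpreted[OF I Xs])
    show ?thesis
    proof (rule ex1I[of _ "{h (fint A f as)}"])
      show "{h (fint A f as)} \<in> univ (interpreted_struc I B ps) \<and>
          interpreted_fun I B ps f Xs {h (fint A f as)}"
        using codes_fint_closed[OF I f as(1)] codes_interpreted_fun[OF I f as(1)] as(2)
          codes_univ[OF I] by auto
      fix Y assume "Y \<in> univ (interpreted_struc I B ps) \<and> interpreted_fun I B ps f Xs Y"
      then show "Y = {h (fint A f as)}"
        using codes_interpreted_fun[OF I f as(1)] as(2) codes_univ[OF I] by auto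
    qed
  qed
  moreover have "wf_interp L L' I (length ps)" "rel_arity L = (\<lambda>_. None)"
    using I unfolding codes_def by blast+
  ultimately show ?thesis
    using equiv unfolding interpretation_in_def by auto
qed

lemma codes_iso:
  assumes I: "codes L A L' B ps I h"
  shows "struc_iso L (\<lambda>a. {h a}) A (interpreted_struc I B ps)"
proof -
  have "{h (fint A f as)} = fint (interpreted_struc I B ps) f (map (\<lambda>a. {h a}) as)"
    if f: "fun_arity L f = Some k" and as: "as \<in> tuples A k" for f k as
  proof -
    have "(THE Y. Y \<in> univ (interpreted_struc I B ps) \<and>
        interpreted_fun I B ps f (map (\<lambda>a. {h a}) as) Y) = {h (fint A f as)}"
    proof (rule the_equality)
      show "{h (fint A f as)} \<in> univ (interpreted_struc I B ps) \<and>
          interpreted_fun I B ps f (map (\<lambda>a. {h a}) as) {h (fint A f as)}"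
        using codes_fint_closed[OF I f as(1)] codes_interpreted_fun[OF I f as(1)]
          codes_univ[OF I] by auto
      fix Y assume "Y \<in> univ (interpreted_struc I B ps) \<and>
          interpreted_fun I B ps f (map (\<lambda>a. {h a}) as) Y"
      then show "Y = {h (fint A f as)}"
        using codes_interpreted_fun[OF I f as(1)] codes_univ[OF I] by auto
    qed
    then show ?thesis by (simp add: interpreted_struc_def)
  qed
  moreover have "rel_arity L = (\<lambda>_. None)" using I unfolding codes_def by blast
  ultimately show ?thesis
    using codes_inj[OF I] codes_univ[OF I] unfolding struc_iso_def bij_betw_def by auto
qed

text \<open>Needed because the other interpretation is evaluated inside this copy.\<close>

lemma codes_closed_copy:
  assumes I: "codes L A L' B ps I h"
  shows "closed_struc L (interpreted_struc I B ps)"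
  unfolding closed_struc_def
proof (intro allI impI ballI)
  fix f k Xs assume f: "fun_arity L f = Some k" and Xs: "Xs \<in> tuples (interpreted_struc I B ps) k"
  obtain as where as: "as \<in> tuples A k" "Xs = map (\<lambda>a. {h a}) as"
    by (rule codes_tuples_interpreted[OF I Xs])
  have "fint (interpreted_struc I B ps) f Xs = {h (fint A f as)}"
    using codes_iso[OF I] f as unfolding struc_iso_def by simp
  then show "fint (interpreted_struc I B ps) f Xs \<in> univ (interpreted_struc I B ps)"
    using codes_fint_closed[OF I f as(1)] codes_univ[OF I] by auto
qed

section \<open>Transport of satisfaction and of interpretations along isomorphisms\<close>

lemma iso_eval_term:
  assumes iso: "struc_iso L h M N" and closed: "closed_struc L M"
  shows "wf_term L n t \<Longrightarrow> (\<And>i. i < n \<Longrightarrow> e i \<in> univ M \<and> e' i = h (e i)) \<Longrightarrow>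
    eval_term M e t \<in> univ M \<and> eval_term N e' t = h (eval_term M e t)"
proof (induction t)
  case (Apply f ts)
  let ?xs = "map (eval_term M e) ts"
  have xs: "?xs \<in> tuples M (length ts)" and eq: "map (eval_term N e') ts = map h ?xs"
    using Apply by (auto simp: tuples_def)
  have f: "fun_arity L f = Some (length ts)" using Apply.prems(1) by simp
  have "fint M f ?xs \<in> univ M" "h (fint M f ?xs) = fint N f (map h ?xs)"
    using f xs iso closed unfolding struc_iso_def closed_struc_def by blast+
  then show ?case by (simp only: eval_term.simps eq)
qed auto

lemma iso_sat:
  assumes iso: "struc_iso L h M N" and closed: "closed_struc L M"
  shows "wf_formula L n p \<Longrightarrow> (\<And>i. i < n \<Longrightarrow> e i \<in> univ M \<and> e' i = h (e i)) \<Longrightarrow>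
    sat N e' p \<longleftrightarrow> sat M e p"
proof (induction p arbitrary: n e e')
  case (Equal s t)
  have "inj_on h (univ M)" using iso unfolding struc_iso_def bij_betw_def by blast
  then show ?case
    using iso_eval_term[OF iso closed, of n s e e'] iso_eval_term[OF iso closed, of n t e e'] Equal
    by (auto simp: inj_on_def)
next
  case (Related r ts)
  let ?xs = "map (eval_term M e) ts"
  have xs: "?xs \<in> tuples M (length ts)" and eq: "map (eval_term N e') ts = map h ?xs"
    using iso_eval_term[OF iso closed, of n _ e e'] Related by (auto simp: tuples_def)
  have "rel_arity L r = Some (length ts)" using Related.prems(1) by simp
  then have "rint M r ?xs \<longleftrightarrow> rint N r (map h ?xs)"
    using xs iso unfolding struc_iso_def by blast
  then show ?case by (simp only: sat.simps eq)
next
  case (Exists p)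
  have img: "univ N = h ` univ M" using iso unfolding struc_iso_def bij_betw_def by blast
  have "sat N (case_nat (h a) e') p \<longleftrightarrow> sat M (case_nat a e) p" if "a \<in> univ M" for a
    using Exists.prems that by (intro Exists.IH[of "Suc n"]) (auto split: nat.split)
  then show ?case unfolding sat.simps img by blast
next
  case (Conjunction p q)
  show ?case
    using Conjunction.prems Conjunction.IH(1)[of n e e'] Conjunction.IH(2)[of n e e'] by simp
next
  case (Negation p)
  show ?case using Negation.prems Negation.IH[of n e e'] by simp
qed

lemma iso_sat_list:
  assumes "struc_iso L h M N" "closed_struc L M" "wf_formula L (length xs) p" "set xs \<subseteq> univ M"
  shows "sat_list N (map h xs) p \<longleftrightarrow> sat_list M xs p"
  using assms(4) by (intro iso_sat[OF assms(1-3)]) auto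

text \<open>Applied with \<open>B'\<close> the copy of \<open>B\<close> inside \<open>A\<close>: the
  same formulas, with the images of the parameters, code \<open>A\<close> there too. This yields the
  composite interpretations demanded by \<open>bi_interpretable\<close>.\<close>

lemma codes_transfer:
  assumes I: "codes L A L' B ps I h" and iso: "struc_iso L' g B B'" and B': "closed_struc L' B'"
  shows "codes L A L' B' (map g ps) I (\<lambda>a. map g (h a))"
proof -
  have B: "closed_struc L' B" and ps: "set ps \<subseteq> univ B" and wf: "wf_interp L L' I (length ps)"
    and inj: "inj_on h (univ A)" and dom: "dom_tuples I B ps = h ` univ A"
    using I unfolding codes_def by blast+
  have img: "univ B' = g ` univ B" and g: "inj_on g (univ B)"
    using iso unfolding struc_iso_def bij_betw_def by blast+
  have h: "length (h a) = interp_dim I" "set (h a) \<subseteq> univ B" if "a \<in> univ A" for a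
    using codes_tuples[OF I that] by (auto simp: tuples_def)
  have "dom_tuples I B' (map g ps) = map g ` dom_tuples I B ps"
  proof -
    have "sat_list B' (map g xs @ map g ps) (interp_dom I) \<longleftrightarrow> sat_list B (xs @ ps) (interp_dom I)"
      if "xs \<in> tuples B (interp_dim I)" for xs
      using iso_sat_list[OF iso B, of "xs @ ps" "interp_dom I"] that ps wf
      by (auto simp: wf_interp_def tuples_def)
    moreover have "tuples B' (interp_dim I) = map g ` tuples B (interp_dim I)"
    proof -
      have "{xs. length xs = k \<and> set xs \<subseteq> univ B'} = map g ` {xs. length xs = k \<and> set xs \<subseteq> univ B}"
        for k
      proof (intro equalityI subsetI)
        fix xs assume "xs \<in> {xs. length xs = k \<and> set xs \<subseteq> univ B'}"
        then have "xs \<in> lists (g ` univ B)" and len: "length xs = k"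
          by (auto simp: in_lists_conv_set img)
        then obtain ys where "ys \<in> lists (univ B)" "xs = map g ys" unfolding lists_image by blast
        then show "xs \<in> map g ` {xs. length xs = k \<and> set xs \<subseteq> univ B}" using len by auto
      qed (auto simp: img subset_iff)
      then show ?thesis unfolding tuples_def .
    qed
    ultimately show ?thesis unfolding dom_tuples_def by auto
  qed
  then have dom': "dom_tuples I B' (map g ps) = (\<lambda>a. map g (h a)) ` univ A"
    by (simp add: dom image_image)
  have inj': "inj_on (\<lambda>a. map g (h a)) (univ A)"
  proof (rule inj_onI)
    fix a b assume ab: "a \<in> univ A" "b \<in> univ A" "map g (h a) = map g (h b)"
    have "inj_on g (set (h a) \<union> set (h b))" by (rule inj_on_subset[OF g]) (use h ab in auto)
    then have "h a = h b" using ab(3) by (simp add: inj_on_map_eq_map)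
    then show "a = b" using inj ab by (auto simp: inj_on_def)
  qed
  have eq': "sat_list B' (map g (h a) @ map g (h b) @ map g ps) (interp_eq I) \<longleftrightarrow> a = b"
    if ab: "a \<in> univ A" "b \<in> univ A" for a b
  proof -
    have "sat_list B (h a @ h b @ ps) (interp_eq I) \<longleftrightarrow> a = b"
      using I ab unfolding codes_def by blast
    moreover have "wf_formula L' (length (h a @ h b @ ps)) (interp_eq I)"
      using wf h ab by (simp add: wf_interp_def mult_2 add.assoc)
    ultimately show ?thesis
      using iso_sat_list[OF iso B, of "h a @ h b @ ps" "interp_eq I"] h ab ps by simp
  qed
  have fun': "sat_list B' (concat (map (\<lambda>a. map g (h a)) as) @ map g (h b) @ map g ps) (interp_fun I f)
      \<longleftrightarrow> fint A f as = b"
    if f: "fun_arity L f = Some k" and as: "as \<in> tuples A k" and b: "b \<in> univ A" for f k as b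
  proof -
    let ?xs = "concat (map h as) @ h b @ ps"
    have "sat_list B ?xs (interp_fun I f) \<longleftrightarrow> fint A f as = b"
      using I f as b unfolding codes_def by blast
    moreover have "length (concat (map h as)) = k * interp_dim I"
    proof -
      have "length (concat (map h as)) = length as * interp_dim I" if "set as \<subseteq> univ A" for as
        using that by (induction as) (auto simp: h)
      then show ?thesis using as by (auto simp: tuples_def)
    qed
    then have "wf_formula L' (length ?xs) (interp_fun I f)"
      using wf h(1)[OF b] f by (simp add: wf_interp_def algebra_simps)
    moreover have "set ?xs \<subseteq> univ B" using h as b ps by (auto simp: tuples_def)
    ultimately show ?thesis
      using iso_sat_list[OF iso B, of ?xs "interp_fun I f"]
      by (simp add: map_concat comp_def)
  qed
  have "set (map g ps) \<subseteq> univ B'" using ps img by auto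
  then show ?thesis
    using I dom' inj' eq' fun' B' wf unfolding codes_def by simp
qed

text \<open>Singleton classes leave each element exactly one flat representative, so the graph loses
  its quantification over representatives.\<close>

lemma codes_flat_graph:
  assumes G: "codes L' B L A qs \<Gamma> h'"
    and h: "\<And>a. a \<in> univ A \<Longrightarrow> length (h a) = k \<and> set (h a) \<subseteq> univ B"
  shows "flat_graph \<Gamma> A qs k (\<lambda>a. {map (\<lambda>b. {h' b}) (h a)}) = {a # concat (map h' (h a)) | a. a \<in> univ A}"
proof -
  have dom: "dom_tuples \<Gamma> A qs = h' ` univ B" using G unfolding codes_def by blast
  have "(length wss = k \<and> set wss \<subseteq> dom_tuples \<Gamma> A qs \<and>
      map (\<lambda>ws. eq_tuples \<Gamma> A qs `` {ws}) wss = map (\<lambda>b. {h' b}) (h a)) \<longleftrightarrow> wss = map h' (h a)"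
    (is "?l \<longleftrightarrow> ?r") if a: "a \<in> univ A" for a wss
  proof
    assume l: ?l
    then have "wss \<in> lists (h' ` univ B)" by (auto simp: dom in_lists_conv_set)
    then obtain bs where bs: "set bs \<subseteq> univ B" "wss = map h' bs"
      unfolding lists_image by (auto simp: in_lists_conv_set)
    have "map (\<lambda>ws. eq_tuples \<Gamma> A qs `` {ws}) wss = map (\<lambda>b. {h' b}) bs"
      using bs codes_class[OF G] by auto
    then have "map (\<lambda>b. {h' b}) bs = map (\<lambda>b. {h' b}) (h a)" using l by simp
    moreover have "inj_on (\<lambda>b. {h' b}) (set bs \<union> set (h a))"
      by (rule inj_on_subset[OF codes_inj[OF G]]) (use bs h[OF a] in auto)
    ultimately show ?r using bs by (simp add: inj_on_map_eq_map)
  next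
    assume ?r
    then show ?l using h[OF a] codes_class[OF G] dom by auto
  qed
  then have "(a \<in> univ A \<and> length wss = k \<and> set wss \<subseteq> dom_tuples \<Gamma> A qs \<and>
      map (\<lambda>ws. eq_tuples \<Gamma> A qs `` {ws}) wss \<in> {map (\<lambda>b. {h' b}) (h a)}) \<longleftrightarrow>
      wss = map h' (h a) \<and> a \<in> univ A" for a wss
    by blast
  then show ?thesis unfolding flat_graph_def by simp
qed

text \<open>The composite isomorphisms send \<open>a\<close> to the class of the images of the
  components of \<open>h a\<close>, and symmetrically. What must still be shown is that these two
  explicit graphs are definable.\<close>

theorem bi_interpretableI:
  assumes D: "codes L A L' B ps \<Delta> h" and G: "codes L' B L A qs \<Gamma> h'"
    and "set ps \<subseteq> Q" "set qs \<subseteq> P"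
    and "definable L A P (1 + interp_dim \<Delta> * interp_dim \<Gamma>) {a # concat (map h' (h a)) | a. a \<in> univ A}"
    and "definable L' B Q (1 + interp_dim \<Gamma> * interp_dim \<Delta>) {b # concat (map h (h' b)) | b. b \<in> univ B}"
  shows "bi_interpretable L A P L' B Q"
proof -
  let ?f = "\<lambda>a. {h a}" and ?g = "\<lambda>b. {h' b}"
  let ?\<phi> = "\<lambda>a. {map ?g (h a)}" and ?\<psi> = "\<lambda>b. {map ?f (h' b)}"
  have "struc_iso L ?\<phi> A (interpreted_struc \<Delta> (interpreted_struc \<Gamma> A qs) (map ?g ps))"
    by (rule codes_iso[OF codes_transfer[OF D codes_iso[OF G] codes_closed_copy[OF G]]])
  moreover have "struc_iso L' ?\<psi> B (interpreted_struc \<Gamma> (interpreted_struc \<Delta> B ps) (map ?f qs))"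
    by (rule codes_iso[OF codes_transfer[OF G codes_iso[OF D] codes_closed_copy[OF D]]])
  moreover have "flat_graph \<Gamma> A qs (interp_dim \<Delta>) ?\<phi> = {a # concat (map h' (h a)) | a. a \<in> univ A}"
    using codes_tuples[OF D] by (intro codes_flat_graph[OF G]) (auto simp: tuples_def)
  moreover have "flat_graph \<Delta> B ps (interp_dim \<Gamma>) ?\<psi> = {b # concat (map h (h' b)) | b. b \<in> univ B}"
    using codes_tuples[OF G] by (intro codes_flat_graph[OF D]) (auto simp: tuples_def)
  ultimately show ?thesis
    unfolding bi_interpretable_def
    using assms(3-6) codes_interpretation[OF D] codes_interpretation[OF G] codes_iso[OF D] codes_iso[OF G]
    by (intro exI[of _ \<Delta>] exI[of _ \<Gamma>] exI[of _ ps] exI[of _ qs] exI[of _ ?f] exI[of _ ?g] conjI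
        exI[of _ ?\<phi>] exI[of _ ?\<psi>]) simp_all
qed

text \<open>Assembles an interpretation from definable predicates: domain \<open>D\<close>, graphs
  \<open>F f\<close>, and equality of tuples as equivalence.\<close>

lemma (in struc_with_params) codes_exist:
  fixes A :: "('g, 's, 'c) struc" and S :: "('g, 's) signature"
  assumes "rel_arity S = (\<lambda>_. None)" "closed_struc S A"
    and h: "inj_on h (univ A)" "h ` univ A \<subseteq> tuples M d"
    and dom: "dfn d D" "\<And>xs. xs \<in> tuples M d \<Longrightarrow> D ((!) xs) \<longleftrightarrow> xs \<in> h ` univ A"
    and funs: "\<And>f k. fun_arity S f = Some k \<Longrightarrow> dfn ((k + 1) * d) (F f)"
      "\<And>f k as b. fun_arity S f = Some k \<Longrightarrow> as \<in> tuples A k \<Longrightarrow> b \<in> univ A \<Longrightarrow>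
        F f ((!) (concat (map h as) @ h b)) \<longleftrightarrow> fint A f as = b"
  obtains I where "codes S A L M ps I h" "interp_dim I = d"
proof -
  obtain p where p: "wf_formula L (d + length ps) p"
    "\<forall>xs \<in> tuples M d. sat_list M (xs @ ps) p \<longleftrightarrow> D ((!) xs)"
    using dfn_formula[OF dom(1)] by blast
  have "dfn (2 * d) (\<lambda>e. \<forall>i<d. e i = e (d + i))"
    by (intro dfn_all_less dfn_eq dfun_var) auto
  then obtain q where q: "wf_formula L (2 * d + length ps) q"
    "\<forall>xs \<in> tuples M (2 * d). sat_list M (xs @ ps) q \<longleftrightarrow> (\<forall>i<d. xs ! i = xs ! (d + i))"
    using dfn_formula by blast
  have "\<forall>f. \<exists>r. \<forall>k. fun_arity S f = Some k \<longrightarrow> wf_formula L ((k + 1) * d + length ps) r \<and>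
      (\<forall>xs \<in> tuples M ((k + 1) * d). sat_list M (xs @ ps) r \<longleftrightarrow> F f ((!) xs))"
  proof
    fix f
    show "\<exists>r. \<forall>k. fun_arity S f = Some k \<longrightarrow> wf_formula L ((k + 1) * d + length ps) r \<and>
      (\<forall>xs \<in> tuples M ((k + 1) * d). sat_list M (xs @ ps) r \<longleftrightarrow> F f ((!) xs))"
    proof (cases "fun_arity S f")
      case (Some k)
      show ?thesis using dfn_formula[OF funs(1)[OF Some]] Some by auto
    qed simp
  qed
  then obtain r where r: "\<And>f k. fun_arity S f = Some k \<Longrightarrow> wf_formula L ((k + 1) * d + length ps) (r f)"
    "\<And>f k xs. fun_arity S f = Some k \<Longrightarrow> xs \<in> tuples M ((k + 1) * d) \<Longrightarrow>
       sat_list M (xs @ ps) (r f) \<longleftrightarrow> F f ((!) xs)"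
    by metis
  \<comment> \<open>There are no relation symbols, so \<open>interp_rel\<close> is subject to no
    condition and any value will do.\<close>
  define I :: "('g, 's, 'f, 'r) interp" where
    "I = \<lparr> interp_dim = d, interp_dom = p, interp_eq = q, interp_fun = r, interp_rel = undefined \<rparr>"
  have hd: "length (h a) = d" "set (h a) \<subseteq> univ M" if "a \<in> univ A" for a
    using h(2) that by (auto simp: tuples_def)
  have "dom_tuples I M ps = h ` univ A"
    using p(2) dom(2) h(2) by (auto simp: dom_tuples_def I_def)
  moreover have "sat_list M (h a @ h b @ ps) q \<longleftrightarrow> a = b" if "a \<in> univ A" "b \<in> univ A" for a b
  proof -
    have "h a @ h b \<in> tuples M (2 * d)" using hd that by (auto simp: tuples_def)
    then have "sat_list M (h a @ h b @ ps) q \<longleftrightarrow> h a = h b"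
      using q(2)[rule_format, of "h a @ h b"] hd that by (auto simp: nth_append intro!: nth_equalityI)
    then show ?thesis using h(1) that by (auto simp: inj_on_def)
  qed
  moreover have "sat_list M (concat (map h as) @ h b @ ps) (r f) \<longleftrightarrow> fint A f as = b"
    if f: "fun_arity S f = Some k" and as: "as \<in> tuples A k" and b: "b \<in> univ A" for f k as b
  proof -
    have "length (concat (map h as)) = length as * d" if "set as \<subseteq> univ A" for as
      using that by (induction as) (auto simp: hd)
    then have "concat (map h as) @ h b \<in> tuples M ((k + 1) * d)"
      using as b hd by (auto simp: tuples_def)
    from r(2)[OF f this] funs(2)[OF f as b] show ?thesis by simp
  qed
  moreover have "wf_interp S L I (length ps)"
    using p(1) q(1) r(1) assms(1) by (simp add: wf_interp_def I_def)
  ultimately have "codes S A L M ps I h"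
    unfolding codes_def using assms(1,2) h(1) params closed by (auto simp: I_def)
  then show ?thesis using that by (simp add: I_def)
qed

section \<open>Triangular matrices\<close>

lemma t_mat_carrier [simp]: "t_mat n i j x \<in> carrier_mat n n"
  and t_mat_dim [simp]: "dim_row (t_mat n i j x) = n" "dim_col (t_mat n i j x) = n"
  unfolding t_mat_def e_mat_def by simp_all

lemma t_mat_entry:
  "r < n \<Longrightarrow> s < n \<Longrightarrow>
     t_mat n i j x $$ (r, s) = (if r = s then 1 else 0) + (if r = i \<and> s = j then x else 0)"
  unfolding t_mat_def e_mat_def by simp

definition dg :: "nat \<Rightarrow> (nat \<Rightarrow> 'k::comm_ring_1) \<Rightarrow> 'k mat" where
  "dg n \<delta> = mat n n (\<lambda>(r, s). if r = s then \<delta> r else 0)"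

lemma dg_carrier [simp]: "dg n \<delta> \<in> carrier_mat n n"
  and dg_dim [simp]: "dim_row (dg n \<delta>) = n" "dim_col (dg n \<delta>) = n"
  unfolding dg_def by simp_all

lemma dg_entry: "r < n \<Longrightarrow> s < n \<Longrightarrow> dg n \<delta> $$ (r, s) = (if r = s then \<delta> r else 0)"
  unfolding dg_def by simp_all

lemma d_mat_eq_dg: "d_mat n i u = dg n (\<lambda>r. if r = i then u else 1)"
  unfolding d_mat_def dg_def by (intro eq_matI) auto

lemma mult_mat_carrier [simp]:
  "A \<in> carrier_mat n n \<Longrightarrow> B \<in> carrier_mat n n \<Longrightarrow> A * B \<in> carrier_mat n n"
  by (rule mult_carrier_mat)

lemma mult_mat_entry:
  assumes "A \<in> carrier_mat n n" "B \<in> carrier_mat n n" "i < n" "j < n"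
  shows "(A * B) $$ (i, j) = (\<Sum>k<n. A $$ (i, k) * B $$ (k, j))"
  using assms by (simp add: scalar_prod_def lessThan_atLeast0)

text \<open>From here on entries of products are computed by the special rules for elementary and
  diagonal factors, not by unfolding scalar products.\<close>

declare index_mult_mat(1) [simp del]

lemma sum_single:
  fixes f :: "nat \<Rightarrow> 'a::comm_monoid_add"
  assumes "k < n" "\<And>l. l < n \<Longrightarrow> l \<noteq> k \<Longrightarrow> f l = 0"
  shows "(\<Sum>l<n. f l) = f k"
proof -
  have "(\<Sum>l<n. f l) = (\<Sum>l\<in>{k}. f l)"
    by (rule sum.mono_neutral_right) (use assms in auto)
  then show ?thesis by simp
qed

lemma t_mult_entry:
  fixes A :: "'k::comm_ring_1 mat"
  assumes "A \<in> carrier_mat n n" "r < n" "s < n" "j < n"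
  shows "(t_mat n i j x * A) $$ (r, s) = A $$ (r, s) + (if r = i then x * A $$ (j, s) else 0)"
proof -
  have "(t_mat n i j x * A) $$ (r, s) =
      (\<Sum>k<n. (if r = k then 1 else 0) * A $$ (k, s) + (if r = i \<and> k = j then x else 0) * A $$ (k, s))"
    using assms by (simp add: mult_mat_entry[of _ n] t_mat_entry distrib_right)
  also have "\<dots> = (\<Sum>k<n. (if r = k then 1 else 0) * A $$ (k, s)) +
      (\<Sum>k<n. (if r = i \<and> k = j then x else 0) * A $$ (k, s))"
    by (rule sum.distrib)
  also have "(\<Sum>k<n. (if r = k then 1 else 0) * A $$ (k, s)) = A $$ (r, s)"
    using assms by (subst sum_single[of r]) auto
  also have "(\<Sum>k<n. (if r = i \<and> k = j then x else 0) * A $$ (k, s)) = (if r = i then x * A $$ (j, s) else 0)"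
    using assms by (subst sum_single[of j]) auto
  finally show ?thesis .
qed

lemma dg_mult_entry:
  "A \<in> carrier_mat n n \<Longrightarrow> r < n \<Longrightarrow> s < n \<Longrightarrow> (dg n \<delta> * A) $$ (r, s) = \<delta> r * A $$ (r, s)"
  by (subst mult_mat_entry[of _ n], simp_all, subst sum_single[of r]) (auto simp: dg_entry)

lemma mult_dg_entry:
  "A \<in> carrier_mat n n \<Longrightarrow> r < n \<Longrightarrow> s < n \<Longrightarrow> (A * dg n \<delta>) $$ (r, s) = A $$ (r, s) * \<delta> s"
  by (subst mult_mat_entry[of _ n], simp_all, subst sum_single[of s]) (auto simp: dg_entry)

lemma mat_eqI:
  assumes "A \<in> carrier_mat n n" "B \<in> carrier_mat n n"
    and "\<And>i j. i < n \<Longrightarrow> j < n \<Longrightarrow> A $$ (i, j) = B $$ (i, j)"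
  shows "A = B"
  using assms by (intro eq_matI) auto

lemma t_mat_add: "i < j \<Longrightarrow> j < n \<Longrightarrow> t_mat n i j x * t_mat n i j y = t_mat n i j (x + y)"
  by (rule mat_eqI[of _ n]) (auto simp: t_mult_entry t_mat_entry)

lemma t_mat_zero: "t_mat n i j 0 = 1\<^sub>m n"
  by (rule mat_eqI[of _ n]) (auto simp: t_mat_entry)

lemma t_mat_inj:
  assumes "i < j" "j < n"
  shows "t_mat n i j x = t_mat n i j y \<longleftrightarrow> x = y"
proof
  assume eq: "t_mat n i j x = t_mat n i j y"
  have "t_mat n i j x $$ (i, j) = t_mat n i j y $$ (i, j)" by (simp only: eq)
  then show "x = y" using assms by (simp add: t_mat_entry)
qed simp

text \<open>The commutator relation with the inverses cleared, so that it can be checked by row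
  operations and used directly as an equation in a formula.\<close>

lemma t_mat_commutator:
  assumes "i < k" "k < j" "j < n"
  shows "t_mat n i k x * t_mat n k j y = t_mat n i j (x * y) * (t_mat n k j y * t_mat n i k x)"
  by (rule mat_eqI[of _ n]) (use assms in \<open>auto simp: t_mult_entry t_mat_entry\<close>)

lemma dg_mult: "dg n \<delta> * dg n \<epsilon> = dg n (\<lambda>r. \<delta> r * \<epsilon> r)"
  by (rule mat_eqI[of _ n]) (auto simp: dg_mult_entry dg_entry)

lemma dg_one: "dg n (\<lambda>r. 1) = 1\<^sub>m n"
  by (rule mat_eqI[of _ n]) (auto simp: dg_entry)

lemma upper_triangular_mult:
  fixes A :: "'k::comm_ring_1 mat"
  assumes "A \<in> carrier_mat n n" "B \<in> carrier_mat n n" "upper_triangular A" "upper_triangular B"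
  shows "upper_triangular (A * B)"
proof (rule upper_triangularI)
  fix i j assume ij: "j < i" "i < dim_row (A * B)"
  have "A $$ (i, k) * B $$ (k, j) = 0" if "k < n" for k
  proof (cases "k < i")
    case True
    then have "A $$ (i, k) = 0" using assms ij by (intro upper_triangularD) auto
    then show ?thesis by simp
  next
    case False
    then have "B $$ (k, j) = 0" using assms ij that by (intro upper_triangularD) auto
    then show ?thesis by simp
  qed
  then show "(A * B) $$ (i, j) = 0" using assms ij by (simp add: mult_mat_entry[of _ n])
qed

lemma upper_triangular_mult_diag:
  fixes A :: "'k::comm_ring_1 mat"
  assumes "A \<in> carrier_mat n n" "B \<in> carrier_mat n n" "upper_triangular A" "upper_triangular B" "i < n"
  shows "(A * B) $$ (i, i) = A $$ (i, i) * B $$ (i, i)"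
proof -
  have "A $$ (i, k) * B $$ (k, i) = 0" if "k < n" "k \<noteq> i" for k
  proof (cases "k < i")
    case True
    then have "A $$ (i, k) = 0" using assms by (intro upper_triangularD) auto
    then show ?thesis by simp
  next
    case False
    then have "B $$ (k, i) = 0" using assms that by (intro upper_triangularD) auto
    then show ?thesis by simp
  qed
  then show ?thesis using assms by (simp add: mult_mat_entry[of _ n] sum_single[of i])
qed

text \<open>The carrier of \<open>T_group\<close> does not ask for a triangular inverse. The
  determinant makes the diagonal of \<open>A\<close> nonzero; then columns of \<open>B\<close> are
  cleared from left to right, since entry (i, j) of B * A = 1 reduces to B_ij A_jj once the earlier
  columns vanish below the diagonal.\<close>

lemma upper_triangular_inverse:
  fixes A :: "'k::field mat"
  assumes A: "A \<in> carrier_mat n n" and B: "B \<in> carrier_mat n n" and "upper_triangular A" and BA: "B * A = 1\<^sub>m n"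
  shows "upper_triangular B"
proof -
  have "det B * det A = 1" using det_mult[OF B A] BA by simp
  then have "det A \<noteq> 0" by auto
  then have "prod_list (diag_mat A) \<noteq> 0" using det_upper_triangular[OF assms(3) A] by simp
  then have nz: "A $$ (j, j) \<noteq> 0" if "j < n" for j
    using that A by (auto simp: prod_list_zero_iff diag_mat_def)
  have "B $$ (i, j) = 0" if "j < i" "i < n" for i j
    using that
  proof (induction j rule: less_induct)
    case (less j)
    have "(\<Sum>k<n. B $$ (i, k) * A $$ (k, j)) = B $$ (i, j) * A $$ (j, j)"
    proof (rule sum_single)
      show "j < n" using less.prems by simp
      show "B $$ (i, k) * A $$ (k, j) = 0" if "k < n" "k \<noteq> j" for k
      proof (cases "k < j")
        case True
        then show ?thesis using less by simp
      next
        case False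
        then have "A $$ (k, j) = 0" using assms that by (intro upper_triangularD) auto
        then show ?thesis by simp
      qed
    qed
    moreover have "(B * A) $$ (i, j) = 0" using BA less.prems by simp
    ultimately show ?case using nz[of j] less.prems A B by (simp add: mult_mat_entry[of _ n])
  qed
  then show ?thesis using B by (intro upper_triangularI) auto
qed

text \<open>Only the subring structure is fixed here. Finitely many units, finite generation and the
  parameters come in with \<open>triangular_with_params\<close>.\<close>

locale triangular =
  fixes R :: "'k::field_char_0 ring" and n :: nat
  assumes R_mult: "mult R = (*)" and R_one: "one R = 1" and R_zero: "zero R = 0" and R_add: "add R = (+)"
    and one_closed: "1 \<in> carrier R"
    and diff_closed: "\<And>x y. x \<in> carrier R \<Longrightarrow> y \<in> carrier R \<Longrightarrow> x - y \<in> carrier R"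
    and mult_closed: "\<And>x y. x \<in> carrier R \<Longrightarrow> y \<in> carrier R \<Longrightarrow> x * y \<in> carrier R"
    and n: "n \<ge> 3"
begin

abbreviation \<O> where "\<O> \<equiv> carrier R"
abbreviation T where "T \<equiv> T_group n R"
abbreviation t where "t \<equiv> t_mat n"

lemma zero_closed: "0 \<in> \<O>"
  using diff_closed[OF one_closed one_closed] by simp

lemma minus_closed: "x \<in> \<O> \<Longrightarrow> - x \<in> \<O>"
  using diff_closed[OF zero_closed, of x] by simp

lemma add_closed: "x \<in> \<O> \<Longrightarrow> y \<in> \<O> \<Longrightarrow> x + y \<in> \<O>"
  using diff_closed[OF _ minus_closed, of x y] by simp

lemma sum_closed: "(\<And>i. i \<in> I \<Longrightarrow> f i \<in> \<O>) \<Longrightarrow> (\<Sum>i\<in>I. f i) \<in> \<O>"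
  by (induction I rule: infinite_finite_induct) (auto simp: zero_closed add_closed)

lemmas closed_rules = one_closed zero_closed minus_closed add_closed diff_closed mult_closed

text \<open>\<open>a_inv\<close> is defined by description in the additive monoid, so its value has
  to be identified before the symbol \<open>RMinus\<close> can be handled.\<close>

lemma a_inv_eq:
  assumes "x \<in> \<O>" shows "a_inv R x = - x"
proof -
  interpret R: abelian_group R
    by (rule abelian_groupI)
       (auto simp: R_add R_zero closed_rules add.assoc intro!: bexI[of _ "- _"])
  show ?thesis
    using R.minus_equality[of "- x" x] assms minus_closed[OF assms] by (simp add: R_add R_zero)
qed

lemma Units_iff: "u \<in> Units R \<longleftrightarrow> u \<in> \<O> \<and> u \<noteq> 0 \<and> inverse u \<in> \<O>"
proof
  assume "u \<in> Units R"
  then obtain v where v: "u \<in> \<O>" "v \<in> \<O>" "v * u = 1" by (auto simp: Units_def R_mult R_one)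
  then have "u \<noteq> 0" by auto
  then have "inverse u = v" using v(3) by (simp add: field_simps)
  then show "u \<in> \<O> \<and> u \<noteq> 0 \<and> inverse u \<in> \<O>" using v \<open>u \<noteq> 0\<close> by simp
next
  assume "u \<in> \<O> \<and> u \<noteq> 0 \<and> inverse u \<in> \<O>"
  then show "u \<in> Units R" by (auto simp: Units_def R_mult R_one intro!: bexI[of _ "inverse u"])
qed

lemma monoid_R: "monoid R"
  by (rule monoidI) (auto simp: R_mult R_one closed_rules mult.assoc)

lemma minus_one_unit: "- 1 \<in> Units R" and one_unit: "1 \<in> Units R"
  by (auto simp: Units_iff closed_rules)

lemma index_less: "i < n \<Longrightarrow> j < n \<Longrightarrow> i * n + j < n * n"
proof -
  assume "i < n" "j < n"
  then have "i * n + j < Suc i * n" by simp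
  also have "\<dots> \<le> n * n" using \<open>i < n\<close> by (intro mult_le_mono1) simp
  finally show ?thesis .
qed

section \<open>The group of invertible upper triangular matrices\<close>

lemma T_simps [simp]: "mult T = (*)" "one T = 1\<^sub>m n"
  by (simp_all add: T_group_def)

lemma T_carrier: "A \<in> carrier T \<Longrightarrow> A \<in> carrier_mat n n"
  and T_entry: "A \<in> carrier T \<Longrightarrow> i < n \<Longrightarrow> j < n \<Longrightarrow> A $$ (i, j) \<in> \<O>"
  and T_triangular: "A \<in> carrier T \<Longrightarrow> upper_triangular A"
  by (auto simp: T_group_def mats_over_def)

lemma T_mats_over: "A \<in> carrier T \<Longrightarrow> A \<in> mats_over n R"
  and T_inverse: "A \<in> carrier T \<Longrightarrow> \<exists>B\<in>mats_over n R. A * B = 1\<^sub>m n \<and> B * A = 1\<^sub>m n"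
  unfolding T_group_def by simp_all

lemma T_below_diag: "A \<in> carrier T \<Longrightarrow> j < i \<Longrightarrow> i < n \<Longrightarrow> A $$ (i, j) = 0"
  using T_triangular T_carrier by (metis carrier_matD(1) upper_triangularD)

lemma mats_over_mult: "A \<in> mats_over n R \<Longrightarrow> B \<in> mats_over n R \<Longrightarrow> A * B \<in> mats_over n R"
  unfolding mats_over_def by (auto simp: mult_mat_entry[of _ n] intro!: sum_closed mult_closed)

lemma T_memI:
  assumes "A \<in> mats_over n R" "B \<in> mats_over n R" "upper_triangular A" "A * B = 1\<^sub>m n" "B * A = 1\<^sub>m n"
  shows "A \<in> carrier T"
  unfolding T_group_def using assms by auto

lemma T_mult_closed:
  assumes A: "A \<in> carrier T" and B: "B \<in> carrier T"
  shows "A * B \<in> carrier T"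
proof -
  obtain A' where A': "A' \<in> mats_over n R" "A * A' = 1\<^sub>m n" "A' * A = 1\<^sub>m n"
    using T_inverse[OF A] by blast
  obtain B' where B': "B' \<in> mats_over n R" "B * B' = 1\<^sub>m n" "B' * B = 1\<^sub>m n"
    using T_inverse[OF B] by blast
  have AB: "A \<in> mats_over n R" "B \<in> mats_over n R" using A B T_mats_over by blast+
  have c: "A \<in> carrier_mat n n" "B \<in> carrier_mat n n" "A' \<in> carrier_mat n n" "B' \<in> carrier_mat n n"
    using AB A' B' by (auto simp: mats_over_def)
  have "A * B * (B' * A') = A * (B * B') * A'" "B' * A' * (A * B) = B' * (A' * A) * B"
    using c by (simp_all add: assoc_mult_mat[of _ n n _ n _ n])
  then have "A * B * (B' * A') = 1\<^sub>m n" "B' * A' * (A * B) = 1\<^sub>m n"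
    using c A' B' by simp_all
  then show ?thesis
    using AB A' B' mats_over_mult upper_triangular_mult[OF c(1,2)] A B T_triangular
    by (intro T_memI[of _ "B' * A'"]) auto
qed

lemma group_T: "group T"
proof (rule groupI)
  show "\<one>\<^bsub>T\<^esub> \<in> carrier T"
    by (rule T_memI[of _ "1\<^sub>m n"]) (auto simp: mats_over_def closed_rules)
  fix A assume A: "A \<in> carrier T"
  then obtain A' where A': "A' \<in> mats_over n R" "A * A' = 1\<^sub>m n" "A' * A = 1\<^sub>m n"
    using T_inverse[OF A] by blast
  have "upper_triangular A'"
    by (rule upper_triangular_inverse[OF T_carrier[OF A] _ T_triangular[OF A] A'(3)])
       (use A'(1) in \<open>simp add: mats_over_def\<close>)
  then have "A' \<in> carrier T" using A' T_mats_over[OF A] by (intro T_memI[of _ A]) simp_all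
  then show "\<exists>B\<in>carrier T. B \<otimes>\<^bsub>T\<^esub> A = \<one>\<^bsub>T\<^esub>" using A' by auto
  show "\<one>\<^bsub>T\<^esub> \<otimes>\<^bsub>T\<^esub> A = A" using T_carrier[OF A] by simp
  fix B C assume "B \<in> carrier T" "C \<in> carrier T"
  then show "A \<otimes>\<^bsub>T\<^esub> B \<otimes>\<^bsub>T\<^esub> C = A \<otimes>\<^bsub>T\<^esub> (B \<otimes>\<^bsub>T\<^esub> C)"
    using T_carrier A by (simp add: assoc_mult_mat[of _ n n _ n _ n])
qed (simp add: T_mult_closed)

sublocale T: group T by (rule group_T)

lemma T_cancel:
  "X \<in> carrier T \<Longrightarrow> Y \<in> carrier T \<Longrightarrow> Z \<in> carrier T \<Longrightarrow> Y * X = Z * X \<longleftrightarrow> Y = Z"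
  using T.right_cancel by simp

text \<open>Diagonals of triangular matrices multiply entrywise, and the inverse is triangular with
  entries in \<O>.\<close>

lemma T_diag_unit:
  assumes A: "A \<in> carrier T" and i: "i < n"
  shows "A $$ (i, i) \<in> Units R"
proof -
  let ?B = "inv\<^bsub>T\<^esub> A"
  have B: "?B \<in> carrier T" "A * ?B = 1\<^sub>m n" "?B * A = 1\<^sub>m n"
    using A T.r_inv[OF A] T.l_inv[OF A] by auto
  then have "A $$ (i, i) * ?B $$ (i, i) = 1" "?B $$ (i, i) * A $$ (i, i) = 1"
    using upper_triangular_mult_diag[OF T_carrier T_carrier T_triangular T_triangular, of A ?B i]
      upper_triangular_mult_diag[OF T_carrier T_carrier T_triangular T_triangular, of ?B A i] A i by auto
  then show ?thesis using T_entry A B(1) i by (auto simp: Units_def R_mult R_one)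
qed

lemma t_in_T: "i < j \<Longrightarrow> j < n \<Longrightarrow> x \<in> \<O> \<Longrightarrow> t i j x \<in> carrier T"
  by (rule T_memI[of _ "t i j (- x)"])
     (auto simp: mats_over_def t_mat_entry closed_rules t_mat_add t_mat_zero intro!: upper_triangularI)

lemma dg_in_T:
  assumes "\<And>r. r < n \<Longrightarrow> \<delta> r \<in> Units R"
  shows "dg n \<delta> \<in> carrier T"
proof (rule T_memI[of _ "dg n (\<lambda>r. inverse (\<delta> r))"])
  have "dg n (\<lambda>r. \<delta> r * inverse (\<delta> r)) = dg n (\<lambda>r. 1)"
    by (rule mat_eqI[of _ n]) (use assms in \<open>auto simp: dg_entry Units_iff\<close>)
  then show "dg n \<delta> * dg n (\<lambda>r. inverse (\<delta> r)) = 1\<^sub>m n" "dg n (\<lambda>r. inverse (\<delta> r)) * dg n \<delta> = 1\<^sub>m n"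
    by (simp_all add: dg_mult dg_one mult.commute)
qed (use assms zero_closed in \<open>auto simp: mats_over_def dg_entry Units_iff intro!: upper_triangularI\<close>)

text \<open>This is d_m(-1). It is its own inverse, so \<open>s i * (X * s i)\<close> is a conjugate
  of \<open>X\<close>.\<close>

abbreviation s where "s m \<equiv> dg n (\<lambda>r. if r = m then - 1 else 1)"

text \<open>A matrix that commutes with all \<open>s m\<close>, \<open>m \<notin> {i, j}\<close>, is a diagonal matrix times some
  \<open>t i j x\<close>, and its commutator with \<open>s i\<close> lies in \<open>t i j (2\<O>)\<close>, whatever its diagonal is.\<close>

lemma t_image_iff:
  assumes ij: "i < j" "j < n" and C: "C \<subseteq> \<O>" "\<And>x. x \<in> \<O> \<Longrightarrow> \<exists>c\<in>C. \<exists>y\<in>\<O>. x = c + 2 * y"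
    and Y: "Y \<in> carrier T"
  shows "Y \<in> t i j ` \<O> \<longleftrightarrow> (\<exists>X \<in> carrier T. (\<forall>m<n. m \<noteq> i \<longrightarrow> m \<noteq> j \<longrightarrow> s m * X = X * s m) \<and>
    (\<exists>c\<in>C. Y * X = t i j c * (s i * (X * s i))))"
proof
  assume "Y \<in> t i j ` \<O>"
  then obtain x where x: "x \<in> \<O>" "Y = t i j x" by blast
  obtain c y where c: "c \<in> C" "y \<in> \<O>" "x = c + 2 * y" using C(2)[OF x(1)] by blast
  \<comment> \<open>The witness is \<open>t i j (- y)\<close>: conjugation by \<open>s i\<close>
    turns it into \<open>t i j y\<close>, and x - y = c + y.\<close>
  have "s m * t i j (- y) = t i j (- y) * s m" if "m \<noteq> i" "m \<noteq> j" for m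
    by (rule mat_eqI[of _ n]) (use that in \<open>auto simp: dg_mult_entry mult_dg_entry t_mat_entry\<close>)
  moreover have "t i j x * t i j (- y) = t i j c * (s i * (t i j (- y) * s i))"
    by (rule mat_eqI[of _ n])
       (use ij c in \<open>auto simp: t_mult_entry dg_mult_entry mult_dg_entry t_mat_entry\<close>)
  ultimately show "\<exists>X \<in> carrier T. (\<forall>m<n. m \<noteq> i \<longrightarrow> m \<noteq> j \<longrightarrow> s m * X = X * s m) \<and>
    (\<exists>c\<in>C. Y * X = t i j c * (s i * (X * s i)))"
    using x c t_in_T[OF ij minus_closed[OF c(2)]] by blast
next
  assume "\<exists>X \<in> carrier T. (\<forall>m<n. m \<noteq> i \<longrightarrow> m \<noteq> j \<longrightarrow> s m * X = X * s m) \<and>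
    (\<exists>c\<in>C. Y * X = t i j c * (s i * (X * s i)))"
  then obtain X c where X: "X \<in> carrier T" and
    comm: "\<And>m. m < n \<Longrightarrow> m \<noteq> i \<Longrightarrow> m \<noteq> j \<Longrightarrow> s m * X = X * s m" and
    c: "c \<in> C" "Y * X = t i j c * (s i * (X * s i))" by blast
  have Xc: "X \<in> carrier_mat n n" by (rule T_carrier[OF X])
  have supp: "X $$ (p, q) = 0" if pq: "p < n" "q < n" "p \<noteq> q" "(p, q) \<noteq> (i, j)" for p q
  proof (cases "q < p")
    case True
    then show ?thesis using T_below_diag[OF X] pq by simp
  next
    case False
    \<comment> \<open>Above the diagonal, (i, j) is the only position with both indices in {i, j}.
      Any other position has an index m outside, and commuting with \<open>s m\<close> makes the
      entry equal to its negative.\<close>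
    then have "p \<notin> {i, j} \<or> q \<notin> {i, j}" using pq ij by auto
    then obtain m where m: "m \<in> {p, q}" "m \<noteq> i" "m \<noteq> j" by blast
    then have "(s m * X) $$ (p, q) = (X * s m) $$ (p, q)" using comm[of m] pq by auto
    then show ?thesis using m pq Xc by (auto simp: dg_mult_entry mult_dg_entry)
  qed
  have jj: "X $$ (j, j) \<in> Units R" using T_diag_unit[OF X] ij by simp
  \<comment> \<open>Conjugation by \<open>s i\<close> negates entry (i, j) of \<open>X\<close>,
    while left multiplication by \<open>t i j z\<close> adds z X_jj to it, as row j of
    \<open>X\<close> is diagonal. So z X_jj must be -2 X_ij, solvable in \<O> because X_jj is a
    unit.\<close>
  define z where "z = - 2 * X $$ (i, j) * inverse (X $$ (j, j))"
  have "2 \<in> \<O>" using add_closed[OF one_closed one_closed] by simp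
  then have z: "z \<in> \<O>"
    using jj T_entry[OF X] ij unfolding z_def Units_iff by (auto intro!: closed_rules)
  have "s i * (X * s i) = t i j z * X"
  proof (rule mat_eqI[of _ n])
    fix p q assume pq: "p < n" "q < n"
    have "z * X $$ (j, j) = - 2 * X $$ (i, j)" using jj by (simp add: z_def Units_iff)
    then show "(s i * (X * s i)) $$ (p, q) = (t i j z * X) $$ (p, q)"
      using pq ij Xc supp[OF pq] supp[of j q]
      by (cases "p = q"; cases "(p, q) = (i, j)"; cases "j = q")
         (auto simp: dg_mult_entry mult_dg_entry t_mult_entry)
  qed (use Xc in auto)
  then have "Y * X = t i j (c + z) * X"
    using c Xc ij by (simp add: assoc_mult_mat[of _ n n _ n _ n, symmetric] t_mat_add)
  moreover have "c + z \<in> \<O>" using c C z by (auto intro: add_closed)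
  ultimately show "Y \<in> t i j ` \<O>"
    using T_cancel[of X Y "t i j (c + z)"] X Y t_in_T[OF ij] by auto
qed

end

section \<open>Definability in the group\<close>

text \<open>The theorem gives the parameters as a set; formulas need an ordered list, and
  \<open>ps\<close> is any enumeration of that set.\<close>

locale triangular_with_params = triangular R n for R :: "'k::field_char_0 ring" and n +
  fixes \<alpha>s \<beta>s :: "'k list" and ps :: "'k mat list"
  assumes units_finite: "finite (Units R)" and \<alpha>s: "set \<alpha>s \<subseteq> Units R"
    and \<alpha>s_generate: "generate (units_of R) (set \<alpha>s) = Units R"
    and \<beta>s: "set \<beta>s \<subseteq> carrier R"
    and \<beta>s_span: "\<And>x. x \<in> carrier R \<Longrightarrow> \<exists>c :: nat \<Rightarrow> int. x = (\<Sum>k<length \<beta>s. of_int (c k) * \<beta>s ! k)"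
    and ps: "set ps = t_params n \<beta>s \<union> d_params n \<alpha>s"
begin

abbreviation B where "B \<equiv> group_struc T"

lemma univ_B [simp]: "univ B = carrier T"
  by (simp add: group_struc_def)

lemma closed_B: "closed_struc group_signature B"
  unfolding closed_struc_def
proof (intro allI impI ballI)
  fix f k xs assume f: "fun_arity group_signature f = Some k" and xs: "xs \<in> tuples B k"
  show "fint B f xs \<in> univ B"
  proof (cases f)
    case GOne
    then show ?thesis using f xs T.one_closed by (auto simp: group_signature_def group_struc_def tuples_def)
  next
    case GInv
    then show ?thesis
      using f xs by (auto simp: group_signature_def group_struc_def tuples_def length_Suc_conv)
  next
    case GTimes
    then show ?thesis using f xs T_mult_closed
      by (auto simp: group_signature_def group_struc_def tuples_def length_Suc_conv numeral_2_eq_2)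
  qed
qed

lemma ps_closed: "set ps \<subseteq> carrier T"
proof -
  have "d_mat n i a \<in> carrier T" if "a \<in> set \<alpha>s" for i a
    unfolding d_mat_eq_dg using that \<alpha>s one_unit by (intro dg_in_T) auto
  then show ?thesis using ps \<beta>s t_in_T by (auto simp: t_params_def d_params_def)
qed

sublocale G: struc_with_params group_signature B ps
  by unfold_locales (simp_all add: ps_closed closed_B)

section \<open>Matrices named by words in the parameters\<close>

lemma dfun_mult:
  assumes "G.dfun k F" "G.dfun k F'"
  shows "G.dfun k (\<lambda>e. F e * F' e)"
proof -
  have "G.dfun k (\<lambda>e. fint B GTimes (map (\<lambda>i. (if i = 0 then F else F') e) [0..<2]))"
    using assms by (intro G.dfun_fint) (auto simp: group_signature_def)
  then show ?thesis by (simp add: group_struc_def numeral_2_eq_2)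
qed

text \<open>Says that \<open>A\<close> can be named inside any formula, whatever its number of free
  variables.\<close>

definition const :: "'k mat \<Rightarrow> bool" where
  "const A \<longleftrightarrow> (\<forall>k. G.dfun k (\<lambda>e. A))"

lemma const_dfun: "const A \<Longrightarrow> G.dfun k (\<lambda>e. A)"
  by (simp add: const_def)

lemma const_mult: "const A \<Longrightarrow> const C \<Longrightarrow> const (A * C)"
  unfolding const_def using dfun_mult by blast

lemma const_inv: "const A \<Longrightarrow> const (inv\<^bsub>T\<^esub> A)"
  unfolding const_def
proof
  fix k assume "\<forall>k. G.dfun k (\<lambda>e. A)"
  then have "G.dfun k (\<lambda>e. fint B GInv (map (\<lambda>i. A) [0..<1]))"
    by (intro G.dfun_fint) (auto simp: group_signature_def)
  then show "G.dfun k (\<lambda>e. inv\<^bsub>T\<^esub> A)" by (simp add: group_struc_def)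
qed

lemma const_one: "const (1\<^sub>m n)"
  unfolding const_def
proof
  fix k
  have "G.dfun k (\<lambda>e. fint B GOne (map (\<lambda>i. undefined) [0..<0]))"
    by (rule G.dfun_fint) (auto simp: group_signature_def)
  then show "G.dfun k (\<lambda>e. 1\<^sub>m n)" by (simp add: group_struc_def)
qed

lemma const_param: "A \<in> set ps \<Longrightarrow> const A"
  unfolding const_def using G.dfun_param by blast

lemma inv_t: "i < j \<Longrightarrow> j < n \<Longrightarrow> x \<in> \<O> \<Longrightarrow> inv\<^bsub>T\<^esub> (t i j x) = t i j (- x)"
  using T.inv_equality[of "t i j (- x)" "t i j x"] by (simp add: t_mat_add t_mat_zero t_in_T minus_closed)

text \<open>The x for which \<open>t i j x\<close> can be named form an additive subgroup of \<O>,
  because t_ij is additive, and this subgroup contains the generators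
  \<open>\<beta>s\<close>.\<close>

lemma const_t:
  assumes ij: "i < j" "j < n" and x: "x \<in> \<O>"
  shows "const (t i j x)"
proof -
  define C where "C = {x \<in> \<O>. const (t i j x)}"
  have zero: "0 \<in> C" by (simp add: C_def zero_closed t_mat_zero const_one)
  have add: "x + y \<in> C" if "x \<in> C" "y \<in> C" for x y
    using that const_mult[of "t i j x" "t i j y"] ij by (simp add: C_def add_closed t_mat_add)
  have neg: "- x \<in> C" if "x \<in> C" for x
    using that const_inv[of "t i j x"] ij by (simp add: C_def minus_closed inv_t)
  have nat: "of_nat m * x \<in> C" if "x \<in> C" for m x
    by (induction m) (auto simp: zero distrib_right that intro: add)
  have int: "of_int z * x \<in> C" if "x \<in> C" for z x
    using nat[OF that] neg[OF nat[OF that]] by (cases z rule: int_cases2) auto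
  have sum: "(\<Sum>k\<in>I. f k) \<in> C" if "\<And>k. k \<in> I \<Longrightarrow> f k \<in> C" for I :: "nat set" and f
    using that by (induction I rule: infinite_finite_induct) (auto simp: zero add)
  have "\<beta>s ! k \<in> C" if "k < length \<beta>s" for k
  proof -
    have "\<beta>s ! k \<in> set \<beta>s" using that by simp
    moreover from this have "t i j (\<beta>s ! k) \<in> set ps" using ij unfolding ps t_params_def by blast
    ultimately show ?thesis using \<beta>s by (auto simp: C_def const_param)
  qed
  then have "(\<Sum>k<length \<beta>s. of_int (c k) * \<beta>s ! k) \<in> C" for c :: "nat \<Rightarrow> int"
    by (intro sum int) auto
  then show ?thesis using \<beta>s_span[OF x] by (auto simp: C_def)
qed

text \<open>For fixed i, d_i is a homomorphism on the units, so words in \<open>\<alpha>s\<close>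
  become words in the parameters.\<close>

lemma const_d:
  assumes u: "u \<in> Units R" and i: "i < n"
  shows "const (d_mat n i u)"
proof -
  have d_T: "d_mat n i v \<in> carrier T" if "v \<in> Units R" for v
    unfolding d_mat_eq_dg using that one_unit by (intro dg_in_T) auto
  have d_mult: "d_mat n i v * d_mat n i w = d_mat n i (v * w)" for v w :: 'k
    unfolding d_mat_eq_dg dg_mult by (rule mat_eqI[of _ n]) (auto simp: dg_entry)
  have d_one: "d_mat n i 1 = 1\<^sub>m n"
    unfolding d_mat_eq_dg by (simp add: dg_one)
  interpret R: monoid R by (rule monoid_R)
  interpret U: group "units_of R" by (rule R.units_group)
  have "u \<in> generate (units_of R) (set \<alpha>s)" using u \<alpha>s_generate by simp
  then show ?thesis
  proof (induction rule: generate.induct)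
    case one
    then show ?case by (simp add: units_of_def R_one d_one const_one)
  next
    case (incl h)
    then show ?case using i by (intro const_param) (auto simp: ps d_params_def)
  next
    case (inv h)
    let ?g = "inv\<^bsub>units_of R\<^esub> h"
    have h: "h \<in> Units R" using inv \<alpha>s by auto
    then have g: "?g \<in> Units R" "?g * h = 1"
      using U.inv_closed[of h] U.l_inv[of h] by (simp_all add: units_of_def R_mult R_one)
    then have "d_mat n i ?g * d_mat n i h = \<one>\<^bsub>T\<^esub>" by (simp add: d_mult d_one)
    then have "inv\<^bsub>T\<^esub> (d_mat n i h) = d_mat n i ?g"
      using d_T[OF h] d_T[OF g(1)] by (intro T.inv_equality) auto
    moreover have "const (d_mat n i h)"
      using inv i by (intro const_param) (auto simp: ps d_params_def)
    ultimately show ?case using const_inv by metis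
  next
    case (eng g h)
    then show ?case using const_mult[OF eng.IH] by (simp add: units_of_def R_mult d_mult)
  qed
qed

lemma const_dg:
  assumes "\<And>r. r < n \<Longrightarrow> \<delta> r \<in> Units R"
  shows "const (dg n \<delta>)"
proof -
  have "const (dg n (\<lambda>r. if r < m then \<delta> r else 1))" if "m \<le> n" for m
    using that
  proof (induction m)
    case 0
    then show ?case by (simp add: dg_one const_one)
  next
    case (Suc m)
    have "dg n (\<lambda>r. if r < Suc m then \<delta> r else 1) =
        d_mat n m (\<delta> m) * dg n (\<lambda>r. if r < m then \<delta> r else 1)"
      unfolding d_mat_eq_dg dg_mult by (rule mat_eqI[of _ n]) (auto simp: dg_entry less_Suc_eq)
    then show ?case using Suc assms by (simp add: const_mult const_d)
  qed
  moreover have "dg n (\<lambda>r. if r < n then \<delta> r else 1) = dg n \<delta>"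
    by (rule mat_eqI[of _ n]) (auto simp: dg_entry)
  ultimately show ?thesis by (metis order_refl)
qed

lemma const_s: "const (s m)"
  by (rule const_dg) (simp add: one_unit minus_one_unit)

text \<open>Reduce the coefficients of an integer combination of \<open>\<beta>s\<close> modulo 2:
  the remainders 0 and 1 leave finitely many representatives.\<close>

lemma finite_residues: "\<exists>C. finite C \<and> C \<subseteq> \<O> \<and> (\<forall>x\<in>\<O>. \<exists>c\<in>C. \<exists>y\<in>\<O>. x = c + 2 * y)"
proof -
  define comb where "comb c = (\<Sum>k<length \<beta>s. of_int (c ! k) * \<beta>s ! k)" for c
  define C where "C = comb ` {c. set c \<subseteq> {0, 1} \<and> length c = length \<beta>s}"
  have int: "of_int z \<in> \<O>" for z
  proof -
    have nat: "of_nat m \<in> \<O>" for m by (induction m) (auto simp: closed_rules)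
    show ?thesis using nat minus_closed[OF nat] by (cases z rule: int_cases2) auto
  qed
  have comb: "comb c \<in> \<O>" for c
    unfolding comb_def using \<beta>s by (intro sum_closed mult_closed int) auto
  have "\<exists>c\<in>C. \<exists>y\<in>\<O>. x = c + 2 * y" if x: "x \<in> \<O>" for x
  proof -
    obtain c :: "nat \<Rightarrow> int" where c: "x = (\<Sum>k<length \<beta>s. of_int (c k) * \<beta>s ! k)"
      using \<beta>s_span[OF x] by blast
    let ?r = "map (\<lambda>k. c k mod 2) [0..<length \<beta>s]" and ?q = "map (\<lambda>k. c k div 2) [0..<length \<beta>s]"
    have "of_int (c k) = (of_int (c k mod 2) + 2 * of_int (c k div 2) :: 'k)" for k
      using mod_mult_div_eq[of "c k" 2] by (metis of_int_add of_int_mult of_int_numeral)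
    then have "x = comb ?r + 2 * comb ?q"
      by (simp add: c comb_def sum_distrib_left sum.distrib[symmetric] algebra_simps)
    moreover have "comb ?r \<in> C" unfolding C_def by (intro imageI) auto
    ultimately show ?thesis using comb by blast
  qed
  moreover have "finite C" unfolding C_def by (intro finite_imageI finite_lists_length_eq) simp
  moreover have "C \<subseteq> \<O>" unfolding C_def using comb by auto
  ultimately show ?thesis by blast
qed

text \<open>In the characterization \<open>t_image_iff\<close> the quantifier over \<open>C\<close>
  becomes a finite disjunction, and all matrices \<open>s m\<close> and \<open>t i j c\<close> can
  be named.\<close>

lemma dfn_t_image:
  assumes ij: "i < j" "j < n" and F: "G.dfun k F"
  shows "G.dfn k (\<lambda>e. F e \<in> t i j ` \<O>)"
proof (rule G.dfn_comp1[OF _ F])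
  obtain C where C: "finite C" "C \<subseteq> \<O>" "\<And>x. x \<in> \<O> \<Longrightarrow> \<exists>c\<in>C. \<exists>y\<in>\<O>. x = c + 2 * y"
    using finite_residues by blast
  have "G.dfn 1 (\<lambda>e. \<exists>X \<in> univ B. (\<forall>m<n. m \<noteq> i \<longrightarrow> m \<noteq> j \<longrightarrow> s m * X = X * s m) \<and>
    (\<exists>c\<in>C. e 0 * X = t i j c * (s i * (X * s i))))"
    using C ij
    by (intro G.dfn_ex G.dfn_conj G.dfn_all_less G.dfn_imp G.dfn_bex G.dfn_bool G.dfn_eq dfun_mult
        const_dfun[OF const_s] const_dfun[OF const_t] G.dfun_var) auto
  then show "G.dfn 1 (\<lambda>e. e 0 \<in> t i j ` \<O>)"
    by (rule G.dfn_cong[rotated]) (simp add: t_image_iff[OF ij C(2,3)])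
qed

text \<open>The links between the matrices \<open>t i j x\<close> with the same \<open>x\<close> come from
  \<^prop>\<open>t i k x * t k j y = t i j (x * y) * (t k j y * t i k x)\<close> with \<open>x = 1\<close> or \<open>y = 1\<close>.\<close>

lemma dfn_link_row:
  assumes ij: "i < j" "j < n"
  shows "G.dfn 2 (\<lambda>e. \<exists>x\<in>\<O>. e 0 = t i (n - 1) x \<and> e 1 = t i j x)"
\<comment> \<open>In the last column the two matrices coincide, and there is no room for a
  commutator.\<close>
proof (cases "j = n - 1")
  case True
  have "G.dfn 2 (\<lambda>e. e 1 \<in> t i j ` \<O> \<and> e 0 = e 1)"
    by (intro G.dfn_conj G.dfn_eq dfn_t_image ij G.dfun_var) auto
  then show ?thesis by (rule G.dfn_cong[rotated]) (use True in auto)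
next
  case False
  then have j: "j < n - 1" "n - 1 < n" using ij by auto
  \<comment> \<open>Once \<open>e 1\<close> is known to be some \<open>t i j x\<close>, cancellation
    shows that the equation has \<open>t i (n - 1) x\<close> as its only solution for
    \<open>e 0\<close>.\<close>
  have "G.dfn 2 (\<lambda>e. e 1 \<in> t i j ` \<O> \<and>
      e 1 * t j (n - 1) 1 = e 0 * (t j (n - 1) 1 * e 1))"
    using j by (intro G.dfn_conj G.dfn_eq dfn_t_image ij dfun_mult const_dfun[OF const_t] G.dfun_var one_closed) auto
  then show ?thesis
  proof (rule G.dfn_cong[rotated])
    fix e :: "nat \<Rightarrow> 'k mat" assume "\<And>i. i < 2 \<Longrightarrow> e i \<in> univ B"
    then have e0: "e 0 \<in> carrier T" by simp
    have "t i j x * t j (n - 1) 1 = e 0 * (t j (n - 1) 1 * t i j x) \<longleftrightarrow> e 0 = t i (n - 1) x"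
      if x: "x \<in> \<O>" for x
    proof -
      have "t j (n - 1) 1 * t i j x \<in> carrier T"
        using x j ij by (intro T_mult_closed t_in_T one_closed) auto
      then have "t i (n - 1) x * (t j (n - 1) 1 * t i j x) = e 0 * (t j (n - 1) 1 * t i j x) \<longleftrightarrow>
          t i (n - 1) x = e 0"
        using T_cancel[of "t j (n - 1) 1 * t i j x" "t i (n - 1) x" "e 0"] e0 t_in_T x j ij by simp
      then show ?thesis using t_mat_commutator[OF ij(1) j, of x 1] by auto
    qed
    then show "(\<exists>x\<in>\<O>. e 0 = t i (n - 1) x \<and> e 1 = t i j x) \<longleftrightarrow>
        e 1 \<in> t i j ` \<O> \<and> e 1 * t j (n - 1) 1 = e 0 * (t j (n - 1) 1 * e 1)"
      by auto
  qed
qed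

abbreviation \<tau> where "\<tau> \<equiv> t 0 (n - 1)"

lemma \<tau>_in_T: "x \<in> \<O> \<Longrightarrow> \<tau> x \<in> carrier T"
  using n by (intro t_in_T) auto

lemma \<tau>_inj: "\<tau> x = \<tau> y \<longleftrightarrow> x = y"
  using n by (intro t_mat_inj) auto

lemma dfn_link_col:
  assumes i: "i < n - 1"
  shows "G.dfn 2 (\<lambda>e. \<exists>x\<in>\<O>. e 0 = \<tau> x \<and> e 1 = t i (n - 1) x)"
proof (cases "i = 0")
  case True
  have "G.dfn 2 (\<lambda>e. e 1 \<in> t i (n - 1) ` \<O> \<and> e 0 = e 1)"
    using i by (intro G.dfn_conj G.dfn_eq dfn_t_image G.dfun_var) auto
  then show ?thesis by (rule G.dfn_cong[rotated]) (use True in auto)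
next
  case False
  then have i': "0 < i" "i < n - 1" "n - 1 < n" using i by auto
  have "G.dfn 2 (\<lambda>e. e 1 \<in> t i (n - 1) ` \<O> \<and> t 0 i 1 * e 1 = e 0 * (e 1 * t 0 i 1))"
    using i' by (intro G.dfn_conj G.dfn_eq dfn_t_image dfun_mult const_dfun[OF const_t] G.dfun_var one_closed) auto
  then show ?thesis
  proof (rule G.dfn_cong[rotated])
    fix e :: "nat \<Rightarrow> 'k mat" assume "\<And>i. i < 2 \<Longrightarrow> e i \<in> univ B"
    then have e0: "e 0 \<in> carrier T" by simp
    have "t 0 i 1 * t i (n - 1) x = e 0 * (t i (n - 1) x * t 0 i 1) \<longleftrightarrow> e 0 = \<tau> x"
      if x: "x \<in> \<O>" for x
    proof -
      have "t i (n - 1) x * t 0 i 1 \<in> carrier T"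
        using x i' by (intro T_mult_closed t_in_T one_closed) auto
      then have "\<tau> x * (t i (n - 1) x * t 0 i 1) = e 0 * (t i (n - 1) x * t 0 i 1) \<longleftrightarrow> \<tau> x = e 0"
        using T_cancel[of "t i (n - 1) x * t 0 i 1" "\<tau> x" "e 0"] e0 \<tau>_in_T[OF x] by simp
      then show ?thesis using t_mat_commutator[OF i', of 1 x] by auto
    qed
    then show "(\<exists>x\<in>\<O>. e 0 = \<tau> x \<and> e 1 = t i (n - 1) x) \<longleftrightarrow>
        e 1 \<in> t i (n - 1) ` \<O> \<and> t 0 i 1 * e 1 = e 0 * (e 1 * t 0 i 1)"
      by auto
  qed
qed

text \<open>Two moves, along the row to the last column and then up to row 0. Injectivity of x
  \<mapsto> t_ij(x) guarantees that both moves speak of the same x.\<close>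

lemma dfn_link:
  assumes ij: "i < j" "j < n"
  shows "G.dfn 2 (\<lambda>e. \<exists>x\<in>\<O>. e 0 = \<tau> x \<and> e 1 = t i j x)"
proof -
  have i: "i < n - 1" "n - 1 < n" using ij by auto
  have "G.dfn 2 (\<lambda>e. \<exists>z \<in> univ B. (\<exists>x\<in>\<O>. e 0 = \<tau> x \<and> z = t i (n - 1) x) \<and>
      (\<exists>x\<in>\<O>. z = t i (n - 1) x \<and> e 1 = t i j x))"
    by (intro G.dfn_ex G.dfn_conj G.dfn_comp2[OF dfn_link_col[OF i(1)]] G.dfn_comp2[OF dfn_link_row[OF ij]]
        G.dfun_var) auto
  then show ?thesis
    by (rule G.dfn_cong[rotated]) (use i t_in_T[OF i] in \<open>auto simp: t_mat_inj\<close>)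
qed

text \<open>Here \<open>n \<ge> 3\<close> provides the index 1 strictly between 0 and n - 1: the
  factors are moved to the positions (0, 1) and (1, n - 1), whose commutator lies in the
  corner.\<close>

lemma dfn_product:
  "G.dfn 3 (\<lambda>e. \<exists>x\<in>\<O>. \<exists>y\<in>\<O>. e 0 = \<tau> x \<and> e 1 = \<tau> y \<and> e 2 = \<tau> (x * y))"
proof -
  have o: "0 < (1::nat)" "1 < n" "1 < n - 1" "n - 1 < n" "(0::nat) < n - 1" using n by auto
  have "G.dfn 3 (\<lambda>e. \<exists>u \<in> univ B. \<exists>v \<in> univ B. (\<exists>x\<in>\<O>. e 0 = \<tau> x \<and> u = t 0 1 x) \<and>
      (\<exists>y\<in>\<O>. e 1 = \<tau> y \<and> v = t 1 (n - 1) y) \<and> u * v = e 2 * (v * u))"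
    by (intro G.dfn_ex G.dfn_conj G.dfn_comp2[OF dfn_link[OF o(1,2)]] G.dfn_comp2[OF dfn_link[OF o(3,4)]]
        G.dfn_eq dfun_mult G.dfun_var) auto
  then show ?thesis
  proof (rule G.dfn_cong[rotated])
    fix e :: "nat \<Rightarrow> 'k mat" assume "\<And>i. i < 3 \<Longrightarrow> e i \<in> univ B"
    then have e2: "e 2 \<in> carrier T" by simp
    have "t 0 1 x * t 1 (n - 1) y = e 2 * (t 1 (n - 1) y * t 0 1 x) \<longleftrightarrow> e 2 = \<tau> (x * y)"
      if x: "x \<in> \<O>" and y: "y \<in> \<O>" for x y
    proof -
      have "t 1 (n - 1) y * t 0 1 x \<in> carrier T"
        using x y o by (intro T_mult_closed t_in_T) auto
      then have "\<tau> (x * y) * (t 1 (n - 1) y * t 0 1 x) = e 2 * (t 1 (n - 1) y * t 0 1 x) \<longleftrightarrow>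
          \<tau> (x * y) = e 2"
        using T_cancel[of "t 1 (n - 1) y * t 0 1 x" "\<tau> (x * y)" "e 2"] e2 \<tau>_in_T[OF mult_closed[OF x y]]
        by simp
      then show ?thesis using t_mat_commutator[OF o(1,3,4), of x y] by auto
    qed
    then show "(\<exists>x\<in>\<O>. \<exists>y\<in>\<O>. e 0 = \<tau> x \<and> e 1 = \<tau> y \<and> e 2 = \<tau> (x * y)) \<longleftrightarrow>
        (\<exists>u \<in> univ B. \<exists>v \<in> univ B. (\<exists>x\<in>\<O>. e 0 = \<tau> x \<and> u = t 0 1 x) \<and>
          (\<exists>y\<in>\<O>. e 1 = \<tau> y \<and> v = t 1 (n - 1) y) \<and> u * v = e 2 * (v * u))"
      using t_in_T[OF o(1,2)] t_in_T[OF o(3,4)] by (simp; blast)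
  qed
qed

text \<open>Inserting an entry by a row operation multiplies it by the diagonal entry of row j; the
  factor \<open>c\<close> accounts for this.\<close>

lemma dfn_scaled_link:
  assumes ij: "i < j" "j < n" and c: "c \<in> \<O>"
  shows "G.dfn 2 (\<lambda>e. \<exists>x\<in>\<O>. e 0 = \<tau> (x * c) \<and> e 1 = t i j x)"
proof -
  have o: "(0::nat) < n - 1" "n - 1 < n" using n by auto
  have "G.dfn 2 (\<lambda>e. \<exists>z \<in> univ B. (\<exists>x\<in>\<O>. z = \<tau> x \<and> e 1 = t i j x) \<and>
      (\<exists>x\<in>\<O>. \<exists>y\<in>\<O>. z = \<tau> x \<and> \<tau> c = \<tau> y \<and> e 0 = \<tau> (x * y)))"
    using o c by (intro G.dfn_ex G.dfn_conj G.dfn_comp2[OF dfn_link[OF ij]] G.dfn_comp3[OF dfn_product]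
        const_dfun[OF const_t] G.dfun_var) auto
  then show ?thesis
    by (rule G.dfn_cong[rotated]) (use c \<tau>_in_T in \<open>auto simp: \<tau>_inj[unfolded One_nat_def]\<close>)
qed

text \<open>Entry \<open>(i, j)\<close> has number \<open>i * n + j\<close>. A matrix with diagonal \<open>\<delta>\<close> is built from
  \<open>dg n \<delta>\<close> by inserting its entries in this order: as long as row \<open>j\<close> is still diagonal, left
  multiplication by \<open>t i j x\<close> changes entry \<open>(i, j)\<close> only.\<close>

definition partial_entries :: "(nat \<Rightarrow> 'k) \<Rightarrow> nat \<Rightarrow> (nat \<Rightarrow> 'k mat) \<Rightarrow> bool" where
  "partial_entries \<delta> m e \<longleftrightarrow> e 0 \<in> carrier T \<and> (\<forall>i<n. e 0 $$ (i, i) = \<delta> i) \<and>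
     (\<forall>i<n. \<forall>j<n. i < j \<longrightarrow> (if i * n + j < m then e (Suc (i * n + j)) = \<tau> (e 0 $$ (i, j))
        else e 0 $$ (i, j) = 0))"

lemma index_div_mod: "j < n \<Longrightarrow> (i * n + j) div n = i" "j < n \<Longrightarrow> (i * n + j) mod n = j"
  by simp_all

lemma index_eq: "j < n \<Longrightarrow> q < n \<Longrightarrow> i * n + j = p * n + q \<longleftrightarrow> i = p \<and> j = q"
  using index_div_mod by metis

lemma dfn_partial_entries:
  assumes \<delta>: "\<And>r. r < n \<Longrightarrow> \<delta> r \<in> Units R" and m: "m \<le> n * n"
  shows "G.dfn (Suc (n * n)) (partial_entries \<delta> m)"
  using m
proof (induction m)
  case 0
  have "G.dfn (Suc (n * n)) (\<lambda>e. e 0 = dg n \<delta>)"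
    using \<delta> by (intro G.dfn_eq const_dfun const_dg G.dfun_var) auto
  then show ?case
  proof (rule G.dfn_cong[rotated])
    fix e :: "nat \<Rightarrow> 'k mat" assume "\<And>i. i < Suc (n * n) \<Longrightarrow> e i \<in> univ B"
    then have e0: "e 0 \<in> carrier T" by simp
    have "e 0 = dg n \<delta>" if "partial_entries \<delta> 0 e"
    proof (rule mat_eqI[OF T_carrier[OF e0] dg_carrier])
      fix i j assume "i < n" "j < n"
      then show "e 0 $$ (i, j) = dg n \<delta> $$ (i, j)"
        using that T_below_diag[OF e0, of j i]
        by (cases i j rule: linorder_cases) (auto simp: partial_entries_def dg_entry)
    qed
    moreover have "partial_entries \<delta> 0 e" if "e 0 = dg n \<delta>"
      using that e0 by (auto simp: partial_entries_def dg_entry)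
    ultimately show "partial_entries \<delta> 0 e \<longleftrightarrow> e 0 = dg n \<delta>" by blast
  qed
next
  case (Suc m)
  define i j where "i = m div n" and "j = m mod n"
  have ij: "m = i * n + j" "j < n" "i < n"
    using Suc.prems n by (auto simp: i_def j_def less_mult_imp_div_less)
  have IH: "G.dfn (Suc (n * n)) (partial_entries \<delta> m)" using Suc by simp
  have step: "p * n + q < Suc m \<longleftrightarrow> p * n + q < m \<or> p = i \<and> q = j" if "q < n" for p q
    using index_eq[of q j p i] ij that by (auto simp: less_Suc_eq)
  show ?case
  proof (cases "i < j")
    case False
    have "partial_entries \<delta> (Suc m) e \<longleftrightarrow> partial_entries \<delta> m e" for e
      using False unfolding partial_entries_def by (auto simp: step)
    then show ?thesis using IH by simp
  next
    case True
    have notm: "\<not> i * n + j < m" using ij by simp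
    \<comment> \<open>Row j lies below row i, so all its entries come after number \<open>m\<close>:
      at this stage row j is still diagonal.\<close>
    have later: "\<not> j * n + q < Suc m" for q
    proof -
      have "m < Suc i * n" using ij by simp
      also have "\<dots> \<le> j * n" using True by (intro mult_le_mono1) simp
      finally show ?thesis by simp
    qed
    have \<delta>j: "\<delta> j \<in> \<O>" "\<delta> j \<noteq> 0" "inverse (\<delta> j) \<in> \<O>" using \<delta>[OF ij(2)] by (auto simp: Units_iff)
    \<comment> \<open>\<open>A\<close> is the matrix before the insertion of entry (i, j). The row
      operation creates x * \<delta> j there, and this is the value that variable
      \<open>Suc m\<close> has to carry.\<close>
    let ?S = "\<lambda>e. \<exists>A \<in> univ B. \<exists>Y \<in> univ B. partial_entries \<delta> m (e(0 := A)) \<and>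
      (\<exists>x\<in>\<O>. e (Suc m) = \<tau> (x * \<delta> j) \<and> Y = t i j x) \<and> e 0 = Y * A"
    \<comment> \<open>Under the two quantifiers \<open>Y\<close> is variable 0 and \<open>A\<close>
      is variable 1, and the old variables are shifted by two. Sending variable 0 to 1 therefore
      replaces \<open>e 0\<close> by \<open>A\<close>.\<close>
    have "G.dfn (Suc (Suc (Suc (n * n)))) (\<lambda>e. partial_entries \<delta> m (\<lambda>l. e (if l = 0 then 1 else Suc (Suc l))))"
      by (rule G.dfn_rename[OF IH]) auto
    moreover have "(\<lambda>l. e (if l = 0 then 1 else Suc (Suc l))) = (\<lambda>l. e (Suc (Suc l)))(0 := e (Suc 0))"
      for e :: "nat \<Rightarrow> 'k mat" by auto
    ultimately have rename: "G.dfn (Suc (Suc (Suc (n * n))))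
        (\<lambda>e. partial_entries \<delta> m ((\<lambda>l. e (Suc (Suc l)))(0 := e (Suc 0))))" by (simp only:)
    have "G.dfn (Suc (n * n)) ?S"
      using Suc.prems \<delta>j
      by (intro G.dfn_ex G.dfn_conj rename G.dfn_comp2[OF dfn_scaled_link[OF True ij(2)]] G.dfn_eq
          dfun_mult G.dfun_var) simp_all
    then show ?thesis
    proof (rule G.dfn_cong[rotated])
      fix e :: "nat \<Rightarrow> 'k mat" assume "\<And>i. i < Suc (n * n) \<Longrightarrow> e i \<in> univ B"
      then have e0: "e 0 \<in> carrier T" by simp
      have entry: "(t i j x * A) $$ (p, q) = A $$ (p, q) + (if (p, q) = (i, j) then x * \<delta> j else 0)"
        if A: "A \<in> carrier T" "\<And>p. p < n \<Longrightarrow> A $$ (p, p) = \<delta> p"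
          "\<And>q. q < n \<Longrightarrow> j < q \<Longrightarrow> A $$ (j, q) = 0" and pq: "p < n" "q < n" for A x p q
        using A ij T_carrier[OF A(1)] T_below_diag[OF A(1), of q j] pq
        by (cases q j rule: linorder_cases) (auto simp: t_mult_entry)
      show "partial_entries \<delta> (Suc m) e \<longleftrightarrow> ?S e"
      proof
        assume L: "partial_entries \<delta> (Suc m) e"
        \<comment> \<open>Dividing by the unit \<delta> j finds the row operation that produced the
          entry; its inverse applied to \<open>e 0\<close> gives back the previous matrix.\<close>
        define x where "x = e 0 $$ (i, j) * inverse (\<delta> j)"
        have x: "x \<in> \<O>" unfolding x_def using T_entry[OF e0] ij \<delta>j by (intro mult_closed) auto
        have x\<delta>: "x * \<delta> j = e 0 $$ (i, j)" using \<delta>j by (simp add: x_def)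
        define A where "A = t i j (- x) * e 0"
        have A: "A \<in> carrier T" unfolding A_def
          using True ij x by (intro T_mult_closed t_in_T minus_closed e0) auto
        have "t i j x * A = e 0"
          unfolding A_def using T_carrier[OF e0] True ij
          by (simp add: assoc_mult_mat[of _ n n _ n _ n, symmetric] t_mat_add t_mat_zero)
        moreover have "A $$ (p, q) = (if (p, q) = (i, j) then 0 else e 0 $$ (p, q))"
          if "p < n" "q < n" for p q
          using entry[OF e0, of p q "- x"] L later x\<delta> that True ij
          unfolding A_def partial_entries_def by (auto split: if_splits)
        then have "partial_entries \<delta> m (e(0 := A))"
          using L A True step notm unfolding partial_entries_def by auto
        moreover have "e (Suc m) = \<tau> (x * \<delta> j)"
          using L True ij x\<delta> unfolding partial_entries_def by auto
        ultimately show "?S e"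
        proof (intro bexI conjI)
          show "t i j x = t i j x" ..
        qed (use A x t_in_T[OF True ij(2) x] in simp_all)
      next
        assume "?S e"
        then obtain A x where A: "A \<in> carrier T" "partial_entries \<delta> m (e(0 := A))"
          and x: "x \<in> \<O>" "e (Suc m) = \<tau> (x * \<delta> j)" "e 0 = t i j x * A" by auto
        note A' = A(2)[unfolded partial_entries_def]
        have diag: "A $$ (p, p) = \<delta> p" if "p < n" for p using A' that by simp
        note above = A'[THEN conjunct2, THEN conjunct2, rule_format]
        have Aij: "A $$ (i, j) = 0" using above[OF ij(3,2) True] notm by simp
        have "A $$ (j, q) = 0" if "q < n" "j < q" for q
          using above[OF ij(2) that] later[of q] by simp
        then have e0_entry: "e 0 $$ (p, q) = A $$ (p, q) + (if (p, q) = (i, j) then x * \<delta> j else 0)"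
          if "p < n" "q < n" for p q
          unfolding x(3) using that diag by (intro entry A(1)) auto
        show "partial_entries \<delta> (Suc m) e"
          unfolding partial_entries_def
        proof (intro conjI allI impI)
          show "e 0 $$ (p, p) = \<delta> p" if "p < n" for p
            using e0_entry[OF that that] diag[OF that] True by auto
          show "if p * n + q < Suc m then e (Suc (p * n + q)) = \<tau> (e 0 $$ (p, q))
            else e 0 $$ (p, q) = 0" if "p < n" "q < n" "p < q" for p q
          proof (cases "p = i \<and> q = j")
            case True
            then show ?thesis using e0_entry[OF that(1,2)] Aij x(2) ij(1) by simp
          next
            case False
            have "(p * n + q < Suc m) = (p * n + q < m)" using False step[OF that(2), of p] by blast
            moreover have "e 0 $$ (p, q) = A $$ (p, q)" using e0_entry[OF that(1,2)] False by auto
            ultimately show ?thesis using above[OF that] by (simp only: fun_upd_apply nat.simps if_True if_False refl)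
          qed
        qed (rule e0)
      qed
    qed
  qed
qed

text \<open>Disjunction over all diagonals \<delta>. Since \<open>partial_entries\<close> ties
  variables only to entries above the diagonal, those on and below it are prescribed separately, as
  \<open>\<tau> (\<delta> i)\<close> and \<open>\<tau> 0\<close>.\<close>

lemma dfn_entries:
  "G.dfn (Suc (n * n)) (\<lambda>e. \<forall>i<n. \<forall>j<n. e (Suc (i * n + j)) = \<tau> (e 0 $$ (i, j)))"
proof -
  let ?D = "{..<n} \<rightarrow>\<^sub>E Units R"
  have o: "(0::nat) < n - 1" "n - 1 < n" using n by auto
  have "G.dfn (Suc (n * n)) (\<lambda>e. \<exists>\<delta>\<in>?D. partial_entries \<delta> (n * n) e \<and>
      (\<forall>i<n. e (Suc (i * n + i)) = \<tau> (\<delta> i) \<and> (\<forall>j<i. e (Suc (i * n + j)) = \<tau> 0)))"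
  proof (rule G.dfn_bex)
    show "finite ?D" by (intro finite_PiE units_finite) simp
    fix \<delta> assume "\<delta> \<in> ?D"
    then have \<delta>: "\<delta> i \<in> Units R" "\<delta> i \<in> \<O>" if "i < n" for i
      using that Units_iff by (auto simp: PiE_iff)
    have "G.dfn (Suc (n * n)) (\<lambda>e. e (Suc (i * n + j)) = \<tau> x)" if "i < n" "j < n" "x \<in> \<O>" for i j x
      using o that index_less by (intro G.dfn_eq const_dfun[OF const_t] G.dfun_var) simp_all
    then show "G.dfn (Suc (n * n)) (\<lambda>e. partial_entries \<delta> (n * n) e \<and>
      (\<forall>i<n. e (Suc (i * n + i)) = \<tau> (\<delta> i) \<and> (\<forall>j<i. e (Suc (i * n + j)) = \<tau> 0)))"
      using \<delta> zero_closed by (intro G.dfn_conj G.dfn_all_less dfn_partial_entries) simp_all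
  qed
  then show ?thesis
  proof (rule G.dfn_cong[rotated])
    fix e :: "nat \<Rightarrow> 'k mat" assume "\<And>i. i < Suc (n * n) \<Longrightarrow> e i \<in> univ B"
    then have e0: "e 0 \<in> carrier T" by simp
    let ?P = "\<lambda>\<delta>. partial_entries \<delta> (n * n) e \<and>
      (\<forall>i<n. e (Suc (i * n + i)) = \<tau> (\<delta> i) \<and> (\<forall>j<i. e (Suc (i * n + j)) = \<tau> 0))"
    show "(\<forall>i<n. \<forall>j<n. e (Suc (i * n + j)) = \<tau> (e 0 $$ (i, j))) \<longleftrightarrow> (\<exists>\<delta>\<in>?D. ?P \<delta>)"
    proof
      assume L: "\<forall>i<n. \<forall>j<n. e (Suc (i * n + j)) = \<tau> (e 0 $$ (i, j))"
      \<comment> \<open>The restriction to indices below \<open>n\<close> makes this an extensional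
        function; without extensionality the set \<open>?D\<close> would not be finite.\<close>
      let ?\<delta> = "\<lambda>i\<in>{..<n}. e 0 $$ (i, i)"
      have "?\<delta> \<in> ?D" using T_diag_unit[OF e0] by auto
      moreover have "?P ?\<delta>"
        using L e0 T_below_diag[OF e0] unfolding partial_entries_def by (auto simp: index_less)
      ultimately show "\<exists>\<delta>\<in>?D. ?P \<delta>" by blast
    next
      assume "\<exists>\<delta>\<in>?D. ?P \<delta>"
      then obtain \<delta> where P: "?P \<delta>" by blast
      show "\<forall>i<n. \<forall>j<n. e (Suc (i * n + j)) = \<tau> (e 0 $$ (i, j))"
      proof (intro allI impI)
        fix i j assume "i < n" "j < n"
        then show "e (Suc (i * n + j)) = \<tau> (e 0 $$ (i, j))"
          using P T_below_diag[OF e0, of j i] index_less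
          by (cases i j rule: linorder_cases) (auto simp: partial_entries_def)
      qed
    qed
  qed
qed

end

section \<open>Definability in the ring\<close>

context triangular
begin

abbreviation A where "A \<equiv> ring_struc R"

lemma univ_A [simp]: "univ A = \<O>"
  by (simp add: ring_struc_def)

lemma closed_A: "closed_struc ring_signature A"
  unfolding closed_struc_def
proof (intro allI impI ballI)
  fix f k xs assume f: "fun_arity ring_signature f = Some k" and xs: "xs \<in> tuples A k"
  show "fint A f xs \<in> univ A"
    using f xs
    by (cases f) (auto simp: ring_signature_def ring_struc_def tuples_def length_Suc_conv numeral_2_eq_2
        a_inv_eq R_mult R_one R_zero R_add closed_rules)
qed

text \<open>On the ring side the parameter list is empty: matrix arithmetic only uses 0, 1, sums and
  products.\<close>

sublocale A: struc_with_params ring_signature A "[]"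
  by unfold_locales (simp_all add: closed_A)

lemma A_dfun_binary:
  assumes "A.dfun k F" "A.dfun k F'" "fun_arity ring_signature f = Some 2"
  shows "A.dfun k (\<lambda>e. fint A f [F e, F' e])"
proof -
  have "A.dfun k (\<lambda>e. fint A f (map (\<lambda>i. (if i = 0 then F else F') e) [0..<2]))"
    using assms by (intro A.dfun_fint) auto
  then show ?thesis by (simp add: numeral_2_eq_2)
qed

lemma A_dfun_plus: "A.dfun k F \<Longrightarrow> A.dfun k F' \<Longrightarrow> A.dfun k (\<lambda>e. F e + F' e)"
  using A_dfun_binary[of k F F' RPlus] by (simp add: ring_signature_def ring_struc_def R_add)

lemma A_dfun_times: "A.dfun k F \<Longrightarrow> A.dfun k F' \<Longrightarrow> A.dfun k (\<lambda>e. F e * F' e)"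
  using A_dfun_binary[of k F F' RTimes] by (simp add: ring_signature_def ring_struc_def R_mult)

lemma A_dfun_zero: "A.dfun k (\<lambda>e. 0)"
  using A.dfun_fint[of RZero 0 k "\<lambda>_ _. 0"] by (simp add: ring_signature_def ring_struc_def R_zero)

lemma A_dfun_one: "A.dfun k (\<lambda>e. 1)"
  using A.dfun_fint[of ROne 0 k "\<lambda>_ _. 0"] by (simp add: ring_signature_def ring_struc_def R_one)

lemma A_dfun_sum: "(\<And>l. l < m \<Longrightarrow> A.dfun k (F l)) \<Longrightarrow> A.dfun k (\<lambda>e. \<Sum>l<(m::nat). F l e)"
  by (induction m) (simp_all add: A_dfun_zero A_dfun_plus)

text \<open>The offset \<open>p\<close> allows one formula to speak of several matrices, stored one
  after the other.\<close>

definition env_mat :: "nat \<Rightarrow> (nat \<Rightarrow> 'k) \<Rightarrow> 'k mat" where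
  "env_mat p e = mat n n (\<lambda>(i, j). e (p + (i * n + j)))"

lemma env_mat_carrier [simp]: "env_mat p e \<in> carrier_mat n n"
  by (simp add: env_mat_def)

lemma env_mat_entry: "i < n \<Longrightarrow> j < n \<Longrightarrow> env_mat p e $$ (i, j) = e (p + (i * n + j))"
  by (simp add: env_mat_def)

lemma env_mat_eqI:
  "X \<in> carrier_mat n n \<Longrightarrow> (\<And>i j. i < n \<Longrightarrow> j < n \<Longrightarrow> e (p + (i * n + j)) = X $$ (i, j)) \<Longrightarrow> env_mat p e = X"
  by (rule mat_eqI[of _ n]) (simp_all add: env_mat_entry)

lemma dfun_entry: "p + n * n \<le> k \<Longrightarrow> i < n \<Longrightarrow> j < n \<Longrightarrow> A.dfun k (\<lambda>e. e (p + (i * n + j)))"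
  using index_less[of i j] by (intro A.dfun_var) simp

lemma dfn_mat_eq_env:
  assumes X: "\<And>e. X e \<in> carrier_mat n n"
    and "\<And>i j. i < n \<Longrightarrow> j < n \<Longrightarrow> A.dfun k (\<lambda>e. X e $$ (i, j))"
    and Y: "\<And>e. Y e \<in> carrier_mat n n"
    and "\<And>i j. i < n \<Longrightarrow> j < n \<Longrightarrow> A.dfun k (\<lambda>e. Y e $$ (i, j))"
  shows "A.dfn k (\<lambda>e. X e = Y e)"
proof -
  have "A.dfn k (\<lambda>e. \<forall>i<n. \<forall>j<n. X e $$ (i, j) = Y e $$ (i, j))"
    by (intro A.dfn_all_less A.dfn_eq assms)
  moreover have "(X e = Y e) = (\<forall>i<n. \<forall>j<n. X e $$ (i, j) = Y e $$ (i, j))" for e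
    using mat_eqI[OF X Y] by auto
  ultimately show ?thesis by simp
qed

lemma dfun_env_mat_entry: "p + n * n \<le> k \<Longrightarrow> i < n \<Longrightarrow> j < n \<Longrightarrow> A.dfun k (\<lambda>e. env_mat p e $$ (i, j))"
  using dfun_entry by (simp add: env_mat_entry)

lemma dfun_env_mat_mult_entry:
  "p + n * n \<le> k \<Longrightarrow> q + n * n \<le> k \<Longrightarrow> i < n \<Longrightarrow> j < n \<Longrightarrow>
     A.dfun k (\<lambda>e. (env_mat p e * env_mat q e) $$ (i, j))"
  by (simp add: mult_mat_entry[of _ n] env_mat_entry)
     (intro A_dfun_sum A_dfun_times dfun_entry; simp)

lemma dfun_one_mat_entry: "i < n \<Longrightarrow> j < n \<Longrightarrow> A.dfun k (\<lambda>e. 1\<^sub>m n $$ (i, j))"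
  using A_dfun_one A_dfun_zero by simp

definition entries :: "'k mat \<Rightarrow> 'k list" where
  "entries X = map (\<lambda>l. X $$ (l div n, l mod n)) [0..<n * n]"

lemma length_entries [simp]: "length (entries X) = n * n"
  by (simp add: entries_def)

lemma nth_entries: "i < n \<Longrightarrow> j < n \<Longrightarrow> entries X ! (i * n + j) = X $$ (i, j)"
  using index_less[of i j] by (simp add: entries_def)

lemma index_bounds: "l < n * n \<Longrightarrow> l div n < n \<and> l mod n < n"
  using n by (simp add: less_mult_imp_div_less)

lemma list_eq_entries_iff:
  assumes "length xs = n * n"
  shows "xs = entries X \<longleftrightarrow> (\<forall>i<n. \<forall>j<n. xs ! (i * n + j) = X $$ (i, j))"
proof
  assume r: "\<forall>i<n. \<forall>j<n. xs ! (i * n + j) = X $$ (i, j)"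
  show "xs = entries X"
  proof (rule nth_equalityI)
    fix l assume "l < length xs"
    then have l: "l < n * n" using assms by simp
    then show "xs ! l = entries X ! l"
      using r[rule_format, of "l div n" "l mod n"] index_bounds[OF l] by (simp add: entries_def)
  qed (simp add: assms)
qed (simp add: nth_entries)

lemma entries_in_tuples: "X \<in> carrier T \<Longrightarrow> entries X \<in> tuples A (n * n)"
  using T_entry index_bounds by (auto simp: tuples_def entries_def)

lemma entries_inj: "inj_on entries (carrier T)"
proof (rule inj_onI)
  fix X Y assume XY: "X \<in> carrier T" "Y \<in> carrier T" "entries X = entries Y"
  show "X = Y"
    by (rule mat_eqI[OF T_carrier T_carrier]) (use XY nth_entries in \<open>metis\<close>)+
qed

lemma dfn_T: "A.dfn (n * n) (\<lambda>e. env_mat 0 e \<in> carrier T)"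
proof -
  \<comment> \<open>The quantified inverse occupies the first n * n variables, which pushes the
    given matrix to offset n * n.\<close>
  have inv: "A.dfn (n * n + n * n) (\<lambda>e. env_mat 0 e * env_mat (n * n) e = 1\<^sub>m n \<and> env_mat (n * n) e * env_mat 0 e = 1\<^sub>m n)"
    by (intro A.dfn_conj dfn_mat_eq_env dfun_env_mat_mult_entry dfun_one_mat_entry) simp_all
  have "A.dfn (n * n) (\<lambda>e. (\<forall>i<n. \<forall>j<i. e (0 + (i * n + j)) = 0) \<and> (\<exists>y. (\<forall>i<n * n. y i \<in> univ A) \<and>
      env_mat 0 (\<lambda>i. if i < n * n then y i else e (i - n * n)) *
        env_mat (n * n) (\<lambda>i. if i < n * n then y i else e (i - n * n)) = 1\<^sub>m n \<and>
      env_mat (n * n) (\<lambda>i. if i < n * n then y i else e (i - n * n)) *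
        env_mat 0 (\<lambda>i. if i < n * n then y i else e (i - n * n)) = 1\<^sub>m n))"
    by (intro A.dfn_conj A.dfn_all_less A.dfn_eq dfun_entry A_dfun_zero A.dfn_ex_many[OF inv]) simp_all
  then show ?thesis
  proof (rule A.dfn_cong[rotated])
    fix e :: "nat \<Rightarrow> 'k" assume e: "\<And>i. i < n * n \<Longrightarrow> e i \<in> univ A"
    have shift: "env_mat 0 (\<lambda>i. if i < n * n then y i else e (i - n * n)) = env_mat 0 y"
      "env_mat (n * n) (\<lambda>i. if i < n * n then y i else e (i - n * n)) = env_mat 0 e" for y
      by (rule env_mat_eqI; simp add: env_mat_entry index_less)+
    have over: "env_mat 0 y \<in> mats_over n R" if "\<And>i. i < n * n \<Longrightarrow> y i \<in> \<O>" for y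
      using that index_less by (simp add: mats_over_def env_mat_entry)
    have tri: "upper_triangular (env_mat 0 e) \<longleftrightarrow> (\<forall>i<n. \<forall>j<i. e (0 + (i * n + j)) = 0)"
      unfolding upper_triangular_def by (auto simp: env_mat_def)
    have "(\<exists>B\<in>mats_over n R. env_mat 0 e * B = 1\<^sub>m n \<and> B * env_mat 0 e = 1\<^sub>m n) \<longleftrightarrow>
        (\<exists>y. (\<forall>i<n * n. y i \<in> univ A) \<and> env_mat 0 y * env_mat 0 e = 1\<^sub>m n \<and> env_mat 0 e * env_mat 0 y = 1\<^sub>m n)"
      (is "?l \<longleftrightarrow> ?r")
    proof
      assume ?l
      then obtain B where B: "B \<in> mats_over n R" "env_mat 0 e * B = 1\<^sub>m n" "B * env_mat 0 e = 1\<^sub>m n"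
        by blast
      have "env_mat 0 ((!) (entries B)) = B"
        using B(1) by (intro env_mat_eqI) (simp_all add: mats_over_def nth_entries)
      moreover have "entries B ! i \<in> \<O>" if "i < n * n" for i
        using B(1) index_bounds[OF that] that by (simp add: mats_over_def entries_def)
      ultimately show ?r using B(2,3) by (intro exI[of _ "(!) (entries B)"]) simp
    next
      assume ?r
      then show ?l using over by auto
    qed
    then show "env_mat 0 e \<in> carrier T \<longleftrightarrow> (\<forall>i<n. \<forall>j<i. e (0 + (i * n + j)) = 0) \<and> (\<exists>y. (\<forall>i<n * n. y i \<in> univ A) \<and>
      env_mat 0 (\<lambda>i. if i < n * n then y i else e (i - n * n)) *
        env_mat (n * n) (\<lambda>i. if i < n * n then y i else e (i - n * n)) = 1\<^sub>m n \<and>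
      env_mat (n * n) (\<lambda>i. if i < n * n then y i else e (i - n * n)) *
        env_mat 0 (\<lambda>i. if i < n * n then y i else e (i - n * n)) = 1\<^sub>m n)"
      unfolding shift tri[symmetric] using over e by (simp add: T_group_def)
  qed
qed

end

section \<open>The two interpretations and the two definable isomorphisms\<close>

context triangular_with_params
begin

lemma tuples_1: "as \<in> tuples M 1 \<longleftrightarrow> (\<exists>x\<in>univ M. as = [x])"
  by (auto simp: tuples_def length_Suc_conv)

lemma tuples_2: "as \<in> tuples M 2 \<longleftrightarrow> (\<exists>x\<in>univ M. \<exists>y\<in>univ M. as = [x, y])"
  by (auto simp: tuples_def length_Suc_conv numeral_2_eq_2)

text \<open>The graphs of the group operations are polynomial identities between entries; the
  inverse is described by a product equal to 1, which determines it within the group.\<close>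

lemma matrix_interpretation:
  obtains \<Gamma> where "codes group_signature B ring_signature A [] \<Gamma> entries" "interp_dim \<Gamma> = n * n"
proof (rule A.codes_exist[of group_signature B entries "n * n" "\<lambda>e. env_mat 0 e \<in> carrier T"
      "\<lambda>f. case f of GOne \<Rightarrow> \<lambda>e. env_mat 0 e = 1\<^sub>m n | GInv \<Rightarrow> \<lambda>e. env_mat 0 e * env_mat (n * n) e = 1\<^sub>m n
         | GTimes \<Rightarrow> \<lambda>e. env_mat 0 e * env_mat (n * n) e = env_mat (2 * (n * n)) e"])
  show "rel_arity group_signature = (\<lambda>_. None)" by (simp add: group_signature_def)
  show "closed_struc group_signature B" by (rule closed_B)
  show "inj_on entries (univ B)" "entries ` univ B \<subseteq> tuples A (n * n)"
    using entries_inj entries_in_tuples by auto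
  show "A.dfn (n * n) (\<lambda>e. env_mat 0 e \<in> carrier T)" by (rule dfn_T)
  show "env_mat 0 ((!) xs) \<in> carrier T \<longleftrightarrow> xs \<in> entries ` univ B" if "xs \<in> tuples A (n * n)" for xs
  proof -
    have "length xs = n * n" using that by (simp add: tuples_def)
    then have "xs = entries (env_mat 0 ((!) xs))" by (simp add: list_eq_entries_iff env_mat_entry)
    moreover have "env_mat 0 ((!) (entries X)) = X" if "X \<in> carrier T" for X
      using T_carrier[OF that] by (intro env_mat_eqI) (simp_all add: nth_entries)
    ultimately show ?thesis by auto
  qed
  show "A.dfn ((k + 1) * (n * n)) ((case f of GOne \<Rightarrow> \<lambda>e. env_mat 0 e = 1\<^sub>m n
        | GInv \<Rightarrow> \<lambda>e. env_mat 0 e * env_mat (n * n) e = 1\<^sub>m n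
        | GTimes \<Rightarrow> \<lambda>e. env_mat 0 e * env_mat (n * n) e = env_mat (2 * (n * n)) e))"
    if "fun_arity group_signature f = Some k" for f k
    using that
    by (cases f) (simp_all add: group_signature_def, safe intro!: dfn_mat_eq_env dfun_env_mat_mult_entry
        dfun_one_mat_entry dfun_env_mat_entry, simp_all)
  show "(case f of GOne \<Rightarrow> \<lambda>e. env_mat 0 e = 1\<^sub>m n
        | GInv \<Rightarrow> \<lambda>e. env_mat 0 e * env_mat (n * n) e = 1\<^sub>m n
        | GTimes \<Rightarrow> \<lambda>e. env_mat 0 e * env_mat (n * n) e = env_mat (2 * (n * n)) e)
      ((!) (concat (map entries as) @ entries b)) \<longleftrightarrow> fint B f as = b"
    if f: "fun_arity group_signature f = Some k" and as: "as \<in> tuples B k" and b: "b \<in> univ B" for f k as b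
  proof -
    have env: "env_mat 0 ((!) (entries X @ ys)) = X" "env_mat (n * n) ((!) (xs @ entries X @ ys)) = X"
      "env_mat (2 * (n * n)) ((!) (xs @ xs' @ entries X)) = X"
      if "X \<in> carrier T" "length xs = n * n" "length xs' = n * n" for X xs xs' ys
      using T_carrier[OF that(1)] that(2,3)
      by (auto intro!: env_mat_eqI simp: nth_append nth_entries index_less)
    show ?thesis
    proof (cases f)
      case GOne
      then show ?thesis
        using f as b env(1)[of b "entries b" "entries b" "[]"] by (auto simp: group_signature_def group_struc_def tuples_def)
    next
      case GInv
      then obtain X where X: "X \<in> carrier T" "as = [X]"
        using f as tuples_1[of as B] by (auto simp: group_signature_def)
      have "X * b = 1\<^sub>m n \<longleftrightarrow> inv\<^bsub>T\<^esub> X = b"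
        using T.inv_equality[of b X] T.inv_comm[of X b] T.r_inv[of X] X(1) b by auto
      then show ?thesis
        using GInv X b env(1)[of X "entries X" "entries X" "entries b"] env(2)[of b "entries X" "entries X" "[]"]
        by (simp add: group_struc_def)
    next
      case GTimes
      then obtain X Y where X: "X \<in> carrier T" "Y \<in> carrier T" "as = [X, Y]"
        using f as tuples_2[of as B] by (auto simp: group_signature_def)
      then show ?thesis
        using GTimes b env(1)[of X "entries X" "entries X" "entries Y @ entries b"]
          env(2)[of Y "entries X" "entries X" "entries b"] env(3)[of b "entries X" "entries Y"]
        by (simp add: group_struc_def)
    qed
  qed
qed (rule that)

text \<open>Negation is read off from a product equal to \<open>\<tau> 0\<close>; in the formula for
  multiplication, injectivity of \<open>\<tau>\<close> makes the quantified x and y the actual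
  arguments.\<close>

lemma ring_interpretation:
  obtains \<Delta> where "codes ring_signature A group_signature B ps \<Delta> (\<lambda>x. [\<tau> x])" "interp_dim \<Delta> = 1"
proof (rule G.codes_exist[of ring_signature A "\<lambda>x. [\<tau> x]" 1 "\<lambda>e. e 0 \<in> \<tau> ` \<O>"
      "\<lambda>f. case f of RZero \<Rightarrow> \<lambda>e. e 0 = \<tau> 0 | ROne \<Rightarrow> \<lambda>e. e 0 = \<tau> 1
         | RPlus \<Rightarrow> \<lambda>e. e 0 * e 1 = e 2 | RMinus \<Rightarrow> \<lambda>e. e 0 * e 1 = \<tau> 0
         | RTimes \<Rightarrow> \<lambda>e. \<exists>x\<in>\<O>. \<exists>y\<in>\<O>. e 0 = \<tau> x \<and> e 1 = \<tau> y \<and> e 2 = \<tau> (x * y)"])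
  have o: "(0::nat) < n - 1" "n - 1 < n" using n by auto
  show "rel_arity ring_signature = (\<lambda>_. None)" by (simp add: ring_signature_def)
  show "closed_struc ring_signature A" by (rule closed_A)
  show "inj_on (\<lambda>x. [\<tau> x]) (univ A)" by (rule inj_onI) (use \<tau>_inj in blast)
  show "(\<lambda>x. [\<tau> x]) ` univ A \<subseteq> tuples B 1" using \<tau>_in_T by (auto simp: tuples_def)
  show "G.dfn 1 (\<lambda>e. e 0 \<in> \<tau> ` \<O>)" by (intro dfn_t_image o G.dfun_var) simp
  show "((!) xs) 0 \<in> \<tau> ` \<O> \<longleftrightarrow> xs \<in> (\<lambda>x. [\<tau> x]) ` univ A" if "xs \<in> tuples B 1" for xs
    using that unfolding tuples_1 by auto
  have const: "G.dfun k (\<lambda>e. \<tau> x)" if "x \<in> \<O>" for k x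
    by (rule const_dfun[OF const_t[OF o that]])
  show "G.dfn ((k + 1) * 1) (case f of RZero \<Rightarrow> \<lambda>e. e 0 = \<tau> 0 | ROne \<Rightarrow> \<lambda>e. e 0 = \<tau> 1
         | RPlus \<Rightarrow> \<lambda>e. e 0 * e 1 = e 2 | RMinus \<Rightarrow> \<lambda>e. e 0 * e 1 = \<tau> 0
         | RTimes \<Rightarrow> \<lambda>e. \<exists>x\<in>\<O>. \<exists>y\<in>\<O>. e 0 = \<tau> x \<and> e 1 = \<tau> y \<and> e 2 = \<tau> (x * y))"
    if f: "fun_arity ring_signature f = Some k" for f k
  proof -
    have "G.dfn 1 (\<lambda>e. e 0 = \<tau> 0)" "G.dfn 1 (\<lambda>e. e 0 = \<tau> 1)" "G.dfn 3 (\<lambda>e. e 0 * e 1 = e 2)"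
      "G.dfn 2 (\<lambda>e. e 0 * e 1 = \<tau> 0)"
      by (intro G.dfn_eq dfun_mult const G.dfun_var zero_closed one_closed; simp)+
    then show ?thesis using f dfn_product
      by (cases f) (auto simp: ring_signature_def numeral_3_eq_3 numeral_2_eq_2)
  qed
  show "(case f of RZero \<Rightarrow> \<lambda>e. e 0 = \<tau> 0 | ROne \<Rightarrow> \<lambda>e. e 0 = \<tau> 1
         | RPlus \<Rightarrow> \<lambda>e. e 0 * e 1 = e 2 | RMinus \<Rightarrow> \<lambda>e. e 0 * e 1 = \<tau> 0
         | RTimes \<Rightarrow> \<lambda>e. \<exists>x\<in>\<O>. \<exists>y\<in>\<O>. e 0 = \<tau> x \<and> e 1 = \<tau> y \<and> e 2 = \<tau> (x * y))
      ((!) (concat (map (\<lambda>x. [\<tau> x]) as) @ [\<tau> b])) \<longleftrightarrow> fint A f as = b"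
    if f: "fun_arity ring_signature f = Some k" and as: "as \<in> tuples A k" and b: "b \<in> univ A" for f k as b
  proof (cases f)
    case RZero
    then show ?thesis using f as b \<tau>_inj
      by (auto simp: ring_signature_def ring_struc_def tuples_def R_zero)
  next
    case ROne
    then show ?thesis using f as b \<tau>_inj
      by (auto simp: ring_signature_def ring_struc_def tuples_def R_one)
  next
    case RMinus
    then obtain x where x: "x \<in> \<O>" "as = [x]"
      using f as tuples_1[of as A] by (auto simp: ring_signature_def)
    have "\<tau> x * \<tau> b = \<tau> 0 \<longleftrightarrow> - x = b"
      unfolding t_mat_add[OF o] \<tau>_inj by (auto simp: add_eq_0_iff)
    then show ?thesis using RMinus x by (simp add: ring_struc_def a_inv_eq)
  next
    case RPlus
    then obtain x y where x: "x \<in> \<O>" "y \<in> \<O>" "as = [x, y]"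
      using f as tuples_2[of as A] by (auto simp: ring_signature_def)
    have "\<tau> x * \<tau> y = \<tau> b \<longleftrightarrow> x + y = b"
      unfolding t_mat_add[OF o] \<tau>_inj ..
    then show ?thesis using RPlus x by (simp add: ring_struc_def R_add)
  next
    case RTimes
    then obtain x y where x: "x \<in> \<O>" "y \<in> \<O>" "as = [x, y]"
      using f as tuples_2[of as A] by (auto simp: ring_signature_def)
    have "(\<exists>x'\<in>\<O>. \<exists>y'\<in>\<O>. \<tau> x = \<tau> x' \<and> \<tau> y = \<tau> y' \<and> \<tau> b = \<tau> (x' * y')) \<longleftrightarrow> x * y = b"
      unfolding \<tau>_inj using x by auto
    then show ?thesis using RTimes x by (simp add: ring_struc_def R_mult)
  qed
qed (rule that)

text \<open>All entries of \<open>\<tau> a\<close> are 0 or 1 except the upper right corner, which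
  is \<open>a\<close>. So the ring constants suffice.\<close>

lemma definable_ring_copy:
  "definable ring_signature A {} (1 + 1 * (n * n)) {a # concat (map entries [\<tau> a]) | a. a \<in> univ A}"
proof (rule A.definable_if_dfn)
  let ?R = "\<lambda>e. \<forall>i<n. \<forall>j<n. if i = j then e (1 + (i * n + j)) = 1
      else if i = 0 \<and> j = n - 1 then e (1 + (i * n + j)) = e 0 else e (1 + (i * n + j)) = 0"
  show "A.dfn (1 + 1 * (n * n)) ?R"
    by (intro A.dfn_all_less A.dfn_if A.dfn_eq dfun_entry A_dfun_one A_dfun_zero A.dfun_var) simp_all
  show "{a # concat (map entries [\<tau> a]) | a. a \<in> univ A} \<subseteq> tuples A (1 + 1 * (n * n))"
  proof -
    have "a # entries (\<tau> a) \<in> tuples A (1 + n * n)" if "a \<in> \<O>" for a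
      using entries_in_tuples[OF \<tau>_in_T[OF that]] that by (simp add: tuples_def)
    then show ?thesis by auto
  qed
  fix xs assume "xs \<in> tuples A (1 + 1 * (n * n))"
  then obtain a ys where xs: "xs = a # ys" "a \<in> \<O>" "length ys = n * n"
    by (auto simp: tuples_def length_Suc_conv)
  have "xs \<in> {a # concat (map entries [\<tau> a]) | a. a \<in> univ A} \<longleftrightarrow> ys = entries (\<tau> a)"
    using xs by auto
  also have "\<dots> \<longleftrightarrow> ?R ((!) xs)"
  proof -
    have "ys ! (i * n + j) = \<tau> a $$ (i, j) \<longleftrightarrow> (if i = j then xs ! (1 + (i * n + j)) = 1
      else if i = 0 \<and> j = n - 1 then xs ! (1 + (i * n + j)) = xs ! 0 else xs ! (1 + (i * n + j)) = 0)"
      if "i < n" "j < n" for i j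
      using that n by (simp add: xs(1) t_mat_entry)
    then show ?thesis unfolding list_eq_entries_iff[OF xs(3)] by blast
  qed
  finally show "xs \<in> {a # concat (map entries [\<tau> a]) | a. a \<in> univ A} \<longleftrightarrow> ?R ((!) xs)" .
qed simp

text \<open>In row-major order the composite isomorphism lists \<open>\<tau>\<close> of each matrix
  entry, so its graph is the relation of \<open>dfn_entries\<close>.\<close>

lemma definable_group_copy:
  "definable group_signature B (set ps) (1 + n * n * 1)
     {b # concat (map (\<lambda>x. [\<tau> x]) (entries b)) | b. b \<in> univ B}"
proof (rule G.definable_if_dfn)
  let ?R = "\<lambda>e. \<forall>i<n. \<forall>j<n. e (Suc (i * n + j)) = \<tau> (e 0 $$ (i, j))"
  have concat: "concat (map (\<lambda>x. [\<tau> x]) xs) = map \<tau> xs" for xs by (induction xs) auto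
  show "G.dfn (1 + n * n * 1) ?R" using dfn_entries by simp
  show "{b # concat (map (\<lambda>x. [\<tau> x]) (entries b)) | b. b \<in> univ B} \<subseteq> tuples B (1 + n * n * 1)"
  proof -
    have "b # map \<tau> (entries b) \<in> tuples B (1 + n * n)" if "b \<in> carrier T" for b
      using entries_in_tuples[OF that] that \<tau>_in_T by (auto simp: tuples_def)
    then show ?thesis by (auto simp: concat)
  qed
  fix xs assume "xs \<in> tuples B (1 + n * n * 1)"
  then obtain b ys where xs: "xs = b # ys" "b \<in> carrier T" "length ys = n * n"
    by (auto simp: tuples_def length_Suc_conv)
  have "xs \<in> {b # concat (map (\<lambda>x. [\<tau> x]) (entries b)) | b. b \<in> univ B} \<longleftrightarrow> ys = map \<tau> (entries b)"
    using xs by (auto simp: concat)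
  also have "\<dots> \<longleftrightarrow> (\<forall>l<n * n. ys ! l = \<tau> (entries b ! l))"
    using xs(3) by (auto simp: list_eq_iff_nth_eq)
  also have "\<dots> \<longleftrightarrow> (\<forall>i<n. \<forall>j<n. ys ! (i * n + j) = \<tau> (b $$ (i, j)))"
  proof (intro iffI allI impI)
    fix l assume r: "\<forall>i<n. \<forall>j<n. ys ! (i * n + j) = \<tau> (b $$ (i, j))" and l: "l < n * n"
    show "ys ! l = \<tau> (entries b ! l)"
      using r[rule_format, of "l div n" "l mod n"] index_bounds[OF l] l by (simp add: entries_def)
  next
    fix i j assume "\<forall>l<n * n. ys ! l = \<tau> (entries b ! l)" "i < n" "j < n"
    then show "ys ! (i * n + j) = \<tau> (b $$ (i, j))" using index_less nth_entries by simp
  qed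
  finally show "xs \<in> {b # concat (map (\<lambda>x. [\<tau> x]) (entries b)) | b. b \<in> univ B} \<longleftrightarrow> ?R ((!) xs)"
    by (simp add: xs(1))
qed simp

theorem bi_interpretable_T:
  "bi_interpretable ring_signature A {} group_signature B (t_params n \<beta>s \<union> d_params n \<alpha>s)"
proof -
  obtain \<Delta> where D: "codes ring_signature A group_signature B ps \<Delta> (\<lambda>x. [\<tau> x])" "interp_dim \<Delta> = 1"
    by (rule ring_interpretation)
  obtain \<Gamma> where G: "codes group_signature B ring_signature A [] \<Gamma> entries" "interp_dim \<Gamma> = n * n"
    by (rule matrix_interpretation)
  show ?thesis
    unfolding ps[symmetric]
    by (rule bi_interpretableI[OF D(1) G(1)])
       (use definable_ring_copy definable_group_copy in \<open>simp_all only: D(2) G(2) subset_refl list.set empty_subsetI\<close>)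
qed

end

section \<open>Application to rings of integers\<close>

lemma triangular_ring_of_integers:
  assumes "number_field K" "n \<ge> 3"
  shows "triangular (ring_of_integers K) n"
proof
  have K: "1 \<in> K" "\<And>x y. x \<in> K \<Longrightarrow> y \<in> K \<Longrightarrow> x - y \<in> K" "\<And>x y. x \<in> K \<Longrightarrow> y \<in> K \<Longrightarrow> x * y \<in> K"
    using assms(1) unfolding number_field_def by auto
  show "1 \<in> carrier (ring_of_integers K)"
    using K(1) by (simp add: ring_of_integers_def int_imp_algebraic_int)
  fix x y assume xy: "x \<in> carrier (ring_of_integers K)" "y \<in> carrier (ring_of_integers K)"
  then show "x - y \<in> carrier (ring_of_integers K)"
    using K(2) algebraic_int_add[of x "- y"] by (simp add: ring_of_integers_def)
  show "x * y \<in> carrier (ring_of_integers K)"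
    using xy K(3) algebraic_int_mult[of x y] by (simp add: ring_of_integers_def)
qed (use assms(2) in \<open>simp_all add: ring_of_integers_def\<close>)

theorem theorem3p2:
  fixes K :: "'k::field_char_0 set" and n :: nat and \<alpha>s \<beta>s :: "'k list"
  defines "\<O> \<equiv> ring_of_integers K"
  assumes "n \<ge> 3"
    and "number_field K"
    and "finite (Units \<O>)"
    and "set \<alpha>s \<subseteq> Units \<O>"
    and "generate (units_of \<O>) (set \<alpha>s) = Units \<O>"
    and "free_Z_generators \<beta>s (carrier \<O>)"
  shows "bi_interpretable
           ring_signature (ring_struc \<O>) {}
           group_signature (group_struc (T_group n \<O>)) (t_params n \<beta>s \<union> d_params n \<alpha>s)"
proof -
  \<comment> \<open>The parameter sets are shown to be finite so that they can be listed as
    \<open>ps\<close>.\<close>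
  have "t_params n \<beta>s \<subseteq> (\<Union>i<n. \<Union>j<n. t_mat n i j ` set \<beta>s)"
  proof
    fix X assume "X \<in> t_params n \<beta>s"
    then obtain i j b where X: "X = t_mat n i j b" "i < j" "j < n" "b \<in> set \<beta>s"
      unfolding t_params_def by blast
    then have "i < n" by simp
    with X show "X \<in> (\<Union>i<n. \<Union>j<n. t_mat n i j ` set \<beta>s)" by blast
  qed
  then have "finite (t_params n \<beta>s)" by (rule finite_subset) simp
  moreover have "d_params n \<alpha>s \<subseteq> (\<Union>i<n. d_mat n i ` set \<alpha>s)"
    by (auto simp: d_params_def)
  then have "finite (d_params n \<alpha>s)" by (rule finite_subset) simp
  ultimately obtain ps where ps: "set ps = t_params n \<beta>s \<union> d_params n \<alpha>s"
    using finite_list by blast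
  interpret triangular "ring_of_integers K" n
    by (rule triangular_ring_of_integers[OF assms(3,2)])
  interpret triangular_with_params "ring_of_integers K" n \<alpha>s \<beta>s ps
  proof
    fix x assume "x \<in> carrier (ring_of_integers K)"
    then obtain c :: "int list" where "x = (\<Sum>k<length \<beta>s. of_int (c ! k) * \<beta>s ! k)"
      using assms(7) unfolding free_Z_generators_def \<O>_def by blast
    then show "\<exists>c :: nat \<Rightarrow> int. x = (\<Sum>k<length \<beta>s. of_int (c k) * \<beta>s ! k)" by blast
  qed (use assms(4-7) ps in \<open>auto simp: \<O>_def free_Z_generators_def\<close>)
  show ?thesis unfolding \<O>_def by (rule bi_interpretable_T)
qed

end
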